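(* For the sequential selection with expirations (SSE) problem, Algorithm 1 (defined in the context, run with the exact probabilities $f_{j,t}$) achieves a $\frac12\left(1-\frac1e\right)$-approximation: on every instance, its expected total value is at least $\frac12\left(1-\frac1e\right)$ times the maximum expected total value of an online policy.
   Context: SSE problem. An instance consists of $n$ options. Option $j\in[n]=\{1,\dots,n\}$ has a deterministic value $v_j>0$, a random evaluation time $S_j$ and a random expiration time $E_j$, both taking positive integer values; all these $2n$ random variables are mutually independent, with known distributions and initially unknown realizations. Write $\overline F_{S_j}(t)=\Pr(S_j>t)$ and $p_j(t)=\Pr(E_j>t)$. Standing assumptions: there is $T\in\mathbb N$ with $\overline F_{S_j}(T)=0$ for all $j$, and $p_j(t)>0$ for all $t\ge 1$ and all $j$. Time is discrete, $t=1,2,\dots$. Option $j$ is unexpired at time $t$ iff $E_j>t$; all options are available at time $1$ (so $p_j(1)=1$). A decision-maker (DM) evaluates one option at a time. The DM is free at time 1. If the DM is free at time $t$, it may select one option $j$ that is unexpired at time $t$ and has not been selected before; it is then busy for $S_j$ time units (free again at time $t+S_j$) and obtains value $v_j$. A selected option cannot be preempted and cannot expire. Meanwhile other options may expire. If the DM selects nothing at $t$, it is still free at $t+1$. An online policy decides, when the DM is free, which available option (if any) to select, using only the information revealed so far (past decisions, realized evaluation times of completed options, which options have expired), and possibly internal randomness. Its value is the expected sum of the values of the selected options. Linear program. Maximize $\sum_{t=1}^{nT}\sum_{j=1}^n v_j x_{j,t}$ subject to $\sum_{t=1}^{nT} x_{j,t}/p_j(t)\le 1$ for all $j\in[n]$;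 $\sum_{\tau\le t}\sum_{j=1}^n\overline F_{S_j}(t-\tau)x_{j,\tau}\le 1$ for all $t\in[nT]$; $x_{j,t}\ge0$. Algorithm 1. Let $\mathbf x^*$ be an optimal solution of the linear program (with $x^*_{j,t}=0$ for $t>nT$). Initialize $\mathcal C=[n]$. For $t=1,2,\dots$: if the DM is free at time $t$, form a consideration set $\mathcal C^*$ by adding each $j\in\mathcal C$ independently with probability $\frac{x^*_{j,t}}{2\,p_j(t)\,f_{j,t}}$ (probability $0$ if $x^*_{j,t}=0$), and, if $\mathcal C^*\neq\emptyset$, select an option of maximum value $v_j$ in $\mathcal C^*$. All options in $\mathcal C^*$ (they are said to have been "considered" at time $t$) and all options that expire are removed from $\mathcal C$; thus at each time $\mathcal C$ consists of the unexpired options that have not been considered before. Here $f_{j,t}$ is the conditional probability, given that option $j$ is unexpired at time $t$ (i.e. $E_j>t$), that under this algorithm $j$ has not been considered before time $t$ and the DM is free at time $t$; it is determined by the behaviour of the algorithm at times before $t$. *)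

theory Defs
  imports "HOL-Probability.Probability"
begin

text \<open>
  Instances of the sequential selection problem with expirations. The options are
  \<open>1, \<dots>, opts I\<close>; option \<open>j\<close> has evaluation-time law \<open>eval_law I j\<close> and expiration-time law
  \<open>exp_law I j\<close>.
\<close>

record sse =
  opts :: nat
  val :: "nat \<Rightarrow> real"
  eval_law :: "nat \<Rightarrow> nat pmf"
  exp_law :: "nat \<Rightarrow> nat pmf"

definition Fbar :: "sse \<Rightarrow> nat \<Rightarrow> nat \<Rightarrow> real" where
  "Fbar I j t = measure_pmf.prob (eval_law I j) {s. s > t}"

definition surv :: "sse \<Rightarrow> nat \<Rightarrow> nat \<Rightarrow> real" where
  "surv I j t = measure_pmf.prob (exp_law I j) {e. e > t}"

definition sse_instance :: "sse \<Rightarrow> nat \<Rightarrow> bool" where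
  "sse_instance I T \<longleftrightarrow>
     (\<forall>j\<in>{1..opts I}.
        val I j > 0 \<and>
        set_pmf (eval_law I j) \<subseteq> {1..} \<and>
        set_pmf (exp_law I j) \<subseteq> {1..} \<and>
        Fbar I j T = 0 \<and>
        (\<forall>t\<ge>1. surv I j t > 0) \<and>
        surv I j 1 = 1)"


subsection \<open>Dynamics and online policies\<close>

text \<open>
  A \<open>log\<close> lists the selections made so far as pairs (time of selection, option), latest first.
\<close>

type_synonym log = "(nat \<times> nat) list"

definition selected :: "log \<Rightarrow> nat set" where
  "selected h = snd ` set h"

definition dm_free :: "(nat \<Rightarrow> nat) \<Rightarrow> log \<Rightarrow> nat \<Rightarrow> bool" where
  "dm_free S h t \<longleftrightarrow> (\<forall>(s, j)\<in>set h. s + S j \<le> t)"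

text \<open>
  What the decision-maker knows when it is free: the current time, its past selections, the
  evaluation times of the options it has selected (all completed, since it is free), and the
  expiration times of the unselected options that have expired. As expirations are observed when
  they occur, knowing which options expired at each past time amounts to knowing these
  expiration times; a selected option does not expire, so its expiration time is never revealed.
\<close>

record info =
  now :: nat
  past :: log
  eval_times :: "nat \<rightharpoonup> nat"
  exp_times :: "nat \<rightharpoonup> nat"

definition observe :: "sse \<Rightarrow> nat \<Rightarrow> (nat \<Rightarrow> nat) \<Rightarrow> (nat \<Rightarrow> nat) \<Rightarrow> log \<Rightarrow> info" where
  "observe I t S E h =
     \<lparr>now = t, past = h,
      eval_times = (\<lambda>j. if j \<in> selected h then Some (S j) else None),
      exp_times = (\<lambda>j. if j \<in> {1..opts I} - selected h \<and> E j \<le> t then Some (E j) else None)\<rparr>"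

definition available :: "sse \<Rightarrow> info \<Rightarrow> nat set" where
  "available I z = {j\<in>{1..opts I}. j \<notin> selected (past z) \<and> exp_times z j = None}"

text \<open>
  A decision rule maps the information and a private memory to a random decision
  (\<open>None\<close>: select nothing) and a new memory. The memory type is arbitrary, so a rule may
  correlate its internal randomness over time.
\<close>

type_synonym 'm rule = "info \<Rightarrow> 'm \<Rightarrow> (nat option \<times> 'm) pmf"

definition online_policy :: "sse \<Rightarrow> 'm rule \<Rightarrow> bool" where
  "online_policy I r \<longleftrightarrow>
     (\<forall>z m a m'. (a, m') \<in> set_pmf (r z m) \<longrightarrow> a = None \<or> (\<exists>j\<in>available I z. a = Some j))"

text \<open>
  A state consists of the realized evaluation times \<open>S\<close>, the realized expiration times \<open>E\<close>
  (both drawn once and for all, but seen by a rule only through \<open>observe\<close>), the log and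
  the memory.
\<close>

type_synonym 'm state = "(nat \<Rightarrow> nat) \<times> (nat \<Rightarrow> nat) \<times> log \<times> 'm"

definition initial :: "sse \<Rightarrow> 'm \<Rightarrow> 'm state pmf" where
  "initial I m =
     map_pmf (\<lambda>(S, E). (S, E, [], m))
       (pair_pmf (Pi_pmf {1..opts I} 0 (eval_law I)) (Pi_pmf {1..opts I} 0 (exp_law I)))"

definition step :: "sse \<Rightarrow> nat \<Rightarrow> 'm rule \<Rightarrow> 'm state \<Rightarrow> 'm state pmf" where
  "step I t r = (\<lambda>(S, E, h, m).
     if dm_free S h t
     then map_pmf (\<lambda>(a, m'). (S, E, case a of None \<Rightarrow> h | Some j \<Rightarrow> (t, j) # h, m'))
            (r (observe I t S E h) m)
     else return_pmf (S, E, h, m))"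

text \<open>The law of the state after the decisions at times \<open>1, \<dots>, t\<close>.\<close>

primrec run :: "sse \<Rightarrow> 'm rule \<Rightarrow> 'm \<Rightarrow> nat \<Rightarrow> 'm state pmf" where
  "run I r m 0 = initial I m"
| "run I r m (Suc t) = bind_pmf (run I r m t) (step I (Suc t) r)"

definition expected_reward :: "sse \<Rightarrow> 'm state pmf \<Rightarrow> real" where
  "expected_reward I D =
     measure_pmf.expectation D (\<lambda>(S, E, h, m). \<Sum>(s, j)\<leftarrow>h. val I j)"

text \<open>
  The value collected up to time \<open>t\<close> increases with \<open>t\<close> and is at most the sum of all values, so
  by monotone convergence the expected total value is the following limit; it exists by
  \<open>convergent_expected_reward_run\<close> and \<open>convergent_expected_reward_alg_run\<close> below.
\<close>

definition policy_value :: "sse \<Rightarrow> 'm rule \<Rightarrow> 'm \<Rightarrow> real" where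
  "policy_value I r m = lim (\<lambda>t. expected_reward I (run I r m t))"


subsection \<open>The linear program\<close>

definition lp_objective :: "sse \<Rightarrow> nat \<Rightarrow> (nat \<Rightarrow> nat \<Rightarrow> real) \<Rightarrow> real" where
  "lp_objective I T x = (\<Sum>t=1..opts I * T. \<Sum>j=1..opts I. val I j * x j t)"

definition lp_feasible :: "sse \<Rightarrow> nat \<Rightarrow> (nat \<Rightarrow> nat \<Rightarrow> real) \<Rightarrow> bool" where
  "lp_feasible I T x \<longleftrightarrow>
     (\<forall>j\<in>{1..opts I}. (\<Sum>t=1..opts I * T. x j t / surv I j t) \<le> 1) \<and>
     (\<forall>t\<in>{1..opts I * T}. (\<Sum>\<tau>=1..t. \<Sum>j=1..opts I. Fbar I j (t - \<tau>) * x j \<tau>) \<le> 1) \<and>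
     (\<forall>j\<in>{1..opts I}. \<forall>t\<in>{1..opts I * T}. x j t \<ge> 0)"

definition lp_optimal :: "sse \<Rightarrow> nat \<Rightarrow> (nat \<Rightarrow> nat \<Rightarrow> real) \<Rightarrow> bool" where
  "lp_optimal I T x \<longleftrightarrow>
     lp_feasible I T x \<and> (\<forall>y. lp_feasible I T y \<longrightarrow> lp_objective I T y \<le> lp_objective I T x)"


subsection \<open>The algorithm\<close>

text \<open>
  The memory of the algorithm is the set \<open>K\<close> of options considered so far, and \<open>f j\<close> stands for
  \<open>f\<^sub>j\<^sub>,\<^sub>t\<close> at the current time. Selected options are considered ones, so \<open>available I z - K\<close> is the
  set of unexpired options not considered before. \<open>bernoulli_pmf\<close> truncates its argument to
  \<open>[0, 1]\<close>. The function \<open>pick\<close> chooses an option of maximum value and thereby breaks ties.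
\<close>

definition alg_rule ::
  "sse \<Rightarrow> (nat \<Rightarrow> nat \<Rightarrow> real) \<Rightarrow> (nat set \<Rightarrow> nat) \<Rightarrow> (nat \<Rightarrow> real) \<Rightarrow> nat set rule" where
  "alg_rule I x pick f z K =
     (let t = now z; C = available I z - K in
      map_pmf
        (\<lambda>b. let A = {j\<in>C. b j} in (if A = {} then None else Some (pick A), K \<union> A))
        (Pi_pmf C False (\<lambda>j. bernoulli_pmf (x j t / (2 * surv I j t * f j)))))"

definition max_pick :: "sse \<Rightarrow> (nat set \<Rightarrow> nat) \<Rightarrow> bool" where
  "max_pick I pick \<longleftrightarrow>
     (\<forall>A. A \<subseteq> {1..opts I} \<longrightarrow> A \<noteq> {} \<longrightarrow> pick A \<in> A \<and> (\<forall>j\<in>A. val I j \<le> val I (pick A)))"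

text \<open>
  If \<open>D\<close> is the law of the state after the decisions at times before \<open>t\<close>, this is \<open>f\<^sub>j\<^sub>,\<^sub>t\<close>.
\<close>

definition free_prob :: "nat set state pmf \<Rightarrow> nat \<Rightarrow> nat \<Rightarrow> real" where
  "free_prob D t j =
     cond_prob (measure_pmf D)
       (\<lambda>(S, E, h, K). j \<notin> K \<and> dm_free S h t) (\<lambda>(S, E, h, K). E j > t)"

primrec alg_run ::
  "sse \<Rightarrow> (nat \<Rightarrow> nat \<Rightarrow> real) \<Rightarrow> (nat set \<Rightarrow> nat) \<Rightarrow> nat \<Rightarrow> nat set state pmf" where
  "alg_run I x pick 0 = initial I {}"
| "alg_run I x pick (Suc t) =
     (let D = alg_run I x pick t in
      bind_pmf D (step I (Suc t) (alg_rule I x pick (free_prob D (Suc t)))))"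

definition alg_value :: "sse \<Rightarrow> (nat \<Rightarrow> nat \<Rightarrow> real) \<Rightarrow> (nat set \<Rightarrow> nat) \<Rightarrow> real" where
  "alg_value I x pick = lim (\<lambda>t. expected_reward I (alg_run I x pick t))"


subsection \<open>Existence of the limits\<close>

definition log_ok :: "sse \<Rightarrow> 'm state pmf \<Rightarrow> bool" where
  "log_ok I D \<longleftrightarrow> (\<forall>(S, E, h, m)\<in>set_pmf D. distinct (map snd h) \<and> selected h \<subseteq> {1..opts I})"

lemma online_policy_alg_rule:
  assumes "max_pick I pick"
  shows "online_policy I (alg_rule I x pick f)"
proof -
  have "pick A \<in> available I z" if "A \<noteq> {}" "A \<subseteq> available I z" for A z
  proof -
    have "A \<subseteq> {1..opts I}" using that by (auto simp: available_def)
    then have "pick A \<in> A" using assms that by (simp add: max_pick_def)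
    then show ?thesis using that by blast
  qed
  then have *: "pick {j \<in> available I z - K. b j} \<in> available I z"
    if "{j \<in> available I z - K. b j} \<noteq> {}" for z K b
    using that by (metis (no_types, lifting) DiffD1 mem_Collect_eq subsetI)
  show ?thesis
    unfolding online_policy_def
  proof (intro allI impI)
    fix z K a K'
    assume "(a, K') \<in> set_pmf (alg_rule I x pick f z K)"
    then obtain b where "a = (if {j \<in> available I z - K. b j} = {} then None
        else Some (pick {j \<in> available I z - K. b j}))"
      by (auto simp only: alg_rule_def Let_def set_map_pmf prod.inject)
    then show "a = None \<or> (\<exists>j\<in>available I z. a = Some j)"
      using *[of z K b] by metis
  qed
qed

lemma log_ok_initial: "log_ok I (initial I m)"
  by (auto simp: log_ok_def initial_def selected_def)

lemma log_ok_step: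
  assumes "log_ok I D" "online_policy I r"
  shows "log_ok I (bind_pmf D (step I t r))"
  unfolding log_ok_def
proof clarify
  fix S E h m
  assume "(S, E, h, m) \<in> set_pmf (bind_pmf D (step I t r))"
  then obtain S0 E0 h0 m0 where 0: "(S0, E0, h0, m0) \<in> set_pmf D"
    and 1: "(S, E, h, m) \<in> set_pmf (step I t r (S0, E0, h0, m0))" by auto
  have ok: "distinct (map snd h0)" "selected h0 \<subseteq> {1..opts I}"
    using assms(1) 0 by (auto simp: log_ok_def)
  have "h = h0 \<or> (\<exists>j\<in>{1..opts I}. j \<notin> selected h0 \<and> h = (t, j) # h0)"
    using 1 assms(2)
    by (fastforce simp: step_def online_policy_def available_def observe_def
        split: if_splits option.splits)
  then show "distinct (map snd h) \<and> selected h \<subseteq> {1..opts I}"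
  proof (elim disjE bexE conjE)
    fix j assume "j \<in> {1..opts I}" "j \<notin> selected h0" "h = (t, j) # h0"
    moreover have "selected ((t, j) # h0) = insert j (selected h0)" by (simp add: selected_def)
    ultimately show ?thesis using ok by (simp add: selected_def)
  qed (use ok in simp)
qed

lemma log_reward_bound:
  assumes "log_ok I D" "(S, E, h, m) \<in> set_pmf D" "\<forall>j\<in>{1..opts I}. val I j > 0"
  shows "0 \<le> (\<Sum>(s, j)\<leftarrow>h. val I j)" "(\<Sum>(s, j)\<leftarrow>h. val I j) \<le> (\<Sum>j=1..opts I. val I j)"
proof -
  have ok: "distinct (map snd h)" "selected h \<subseteq> {1..opts I}"
    using assms by (auto simp: log_ok_def)
  have "(\<Sum>(s, j)\<leftarrow>h. val I j) = sum_list (map (val I) (map snd h))"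
    by (simp add: case_prod_unfold comp_def)
  also have "\<dots> = (\<Sum>j\<in>selected h. val I j)"
    by (subst sum_list_distinct_conv_sum_set) (use ok in \<open>auto simp: selected_def\<close>)
  finally have eq: "(\<Sum>(s, j)\<leftarrow>h. val I j) = (\<Sum>j\<in>selected h. val I j)" .
  show "0 \<le> (\<Sum>(s, j)\<leftarrow>h. val I j)"
    unfolding eq using ok(2) assms(3) by (intro sum_nonneg less_imp_le) blast
  show "(\<Sum>(s, j)\<leftarrow>h. val I j) \<le> (\<Sum>j=1..opts I. val I j)"
    unfolding eq
  proof (rule sum_mono2[OF _ ok(2)])
    show "0 \<le> val I j" if "j \<in> {1..opts I} - selected h" for j
      using assms(3) that by (meson DiffD1 less_imp_le)
  qed simp
qed

lemma integrable_reward: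
  assumes "log_ok I D" "\<forall>j\<in>{1..opts I}. val I j > 0"
  shows "integrable (measure_pmf D) (\<lambda>(S, E, h, m). \<Sum>(s, j)\<leftarrow>h. val I j)"
proof (rule measure_pmf.integrable_const_bound[where B = "\<Sum>j=1..opts I. val I j"])
  show "AE u in D. norm (case u of (S, E, h, m) \<Rightarrow> \<Sum>(s, j)\<leftarrow>h. val I j)
          \<le> (\<Sum>j=1..opts I. val I j)"
    unfolding AE_measure_pmf_iff
  proof clarify
    fix S E h m assume u: "(S, E, h, m) \<in> set_pmf D"
    show "norm (\<Sum>(s, j)\<leftarrow>h. val I j) \<le> (\<Sum>j=1..opts I. val I j)"
      using log_reward_bound[OF assms(1) u assms(2)] by (simp only: real_norm_def abs_of_nonneg)
  qed
qed simp

lemma expected_reward_bound: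
  assumes "log_ok I D" "\<forall>j\<in>{1..opts I}. val I j > 0"
  shows "expected_reward I D \<le> (\<Sum>j=1..opts I. val I j)"
  unfolding expected_reward_def
proof (rule measure_pmf.integral_le_const[OF integrable_reward[OF assms]])
  show "AE u in D. (case u of (S, E, h, m) \<Rightarrow> \<Sum>(s, j)\<leftarrow>h. val I j)
          \<le> (\<Sum>j=1..opts I. val I j)"
    unfolding AE_measure_pmf_iff
  proof clarify
    fix S E h m assume "(S, E, h, m) \<in> set_pmf D"
    then show "(\<Sum>(s, j)\<leftarrow>h. val I j) \<le> (\<Sum>j=1..opts I. val I j)"
      by (rule log_reward_bound(2)[OF assms(1) _ assms(2)])
  qed
qed

lemma expected_reward_step:
  assumes "log_ok I D" "online_policy I r" "\<forall>j\<in>{1..opts I}. val I j > 0"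
  shows "expected_reward I D \<le> expected_reward I (bind_pmf D (step I t r))"
proof -
  let ?R = "\<lambda>(S, E, h, m). \<Sum>(s, j)\<leftarrow>h. val I j"
  let ?B = "\<Sum>j=1..opts I. val I j"
  let ?D' = "bind_pmf D (\<lambda>u. map_pmf (Pair u) (step I t r u))"
  have fst: "map_pmf fst ?D' = D"
    by (simp add: map_bind_pmf pmf.map_comp comp_def map_pmf_const bind_return_pmf')
  have snd: "map_pmf snd ?D' = bind_pmf D (step I t r)"
    by (simp add: map_bind_pmf pmf.map_comp comp_def)
  have le: "?R (fst w) \<le> ?R (snd w)" if w: "w \<in> set_pmf ?D'" for w
  proof -
    obtain S E h m S' E' h' m' where [simp]: "w = ((S, E, h, m), (S', E', h', m'))"
      by (metis prod.exhaust)
    have 1: "(S', E', h', m') \<in> set_pmf (step I t r (S, E, h, m))" using w by auto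
    have "h' = h \<or> (\<exists>j\<in>{1..opts I}. h' = (t, j) # h)"
      using 1 assms(2)
      by (fastforce simp: step_def online_policy_def available_def observe_def
          split: if_splits option.splits)
    then show ?thesis
    proof (elim disjE bexE)
      fix j assume "j \<in> {1..opts I}" "h' = (t, j) # h"
      moreover from this have "val I j > 0" using assms(3) by blast
      ultimately show ?thesis by simp
    qed simp
  qed
  have int: "integrable (measure_pmf ?D') (\<lambda>w. ?R (fst w))"
            "integrable (measure_pmf ?D') (\<lambda>w. ?R (snd w))"
  proof -
    have "integrable (measure_pmf (map_pmf fst ?D')) ?R"
      unfolding fst by (rule integrable_reward[OF assms(1,3)])
    then show "integrable (measure_pmf ?D') (\<lambda>w. ?R (fst w))"
      by (simp only: integrable_map_pmf_eq)
    have "integrable (measure_pmf (map_pmf snd ?D')) ?R"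
      unfolding snd by (rule integrable_reward[OF log_ok_step[OF assms(1,2)] assms(3)])
    then show "integrable (measure_pmf ?D') (\<lambda>w. ?R (snd w))"
      by (simp only: integrable_map_pmf_eq)
  qed
  have "expected_reward I D = measure_pmf.expectation ?D' (\<lambda>w. ?R (fst w))"
  proof -
    have "expected_reward I D = measure_pmf.expectation (map_pmf fst ?D') ?R"
      unfolding fst expected_reward_def ..
    then show ?thesis by (simp only: integral_map_pmf)
  qed
  also have "\<dots> \<le> measure_pmf.expectation ?D' (\<lambda>w. ?R (snd w))"
    using le by (intro integral_mono_AE[OF int]) (unfold AE_measure_pmf_iff, blast)
  also have "\<dots> = expected_reward I (bind_pmf D (step I t r))"
  proof -
    have "expected_reward I (bind_pmf D (step I t r))
        = measure_pmf.expectation (map_pmf snd ?D') ?R"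
      unfolding snd expected_reward_def ..
    then show ?thesis by (simp only: integral_map_pmf)
  qed
  finally show ?thesis .
qed

lemma log_ok_run: "online_policy I r \<Longrightarrow> log_ok I (run I r m t)"
  by (induction t) (simp_all add: log_ok_initial log_ok_step)

lemma log_ok_alg_run: "max_pick I pick \<Longrightarrow> log_ok I (alg_run I x pick t)"
  by (induction t) (simp_all add: log_ok_initial log_ok_step online_policy_alg_rule Let_def)

lemma convergent_incseq_bounded:
  fixes X :: "nat \<Rightarrow> real"
  assumes "\<And>t. X t \<le> X (Suc t)" "\<And>t. X t \<le> B"
  shows "convergent X"
proof -
  have "incseq X" using assms(1) by (simp add: incseq_Suc_iff)
  then obtain L where "X \<longlonglongrightarrow> L"
    using incseq_convergent[of X B] assms(2) by blast
  then show ?thesis by (auto simp: convergent_def)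
qed

lemma convergent_expected_reward_run:
  assumes "sse_instance I T" "online_policy I r"
  shows "convergent (\<lambda>t. expected_reward I (run I r m t))"
proof (rule convergent_incseq_bounded)
  fix t
  have pos: "\<forall>j\<in>{1..opts I}. val I j > 0" using assms(1) by (simp add: sse_instance_def)
  show "expected_reward I (run I r m t) \<le> expected_reward I (run I r m (Suc t))"
    using expected_reward_step[OF log_ok_run[OF assms(2)] assms(2) pos] by simp
  show "expected_reward I (run I r m t) \<le> (\<Sum>j=1..opts I. val I j)"
    by (rule expected_reward_bound[OF log_ok_run[OF assms(2)] pos])
qed

lemma convergent_expected_reward_alg_run:
  assumes "sse_instance I T" "max_pick I pick"
  shows "convergent (\<lambda>t. expected_reward I (alg_run I x pick t))"
proof (rule convergent_incseq_bounded)
  fix t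
  have pos: "\<forall>j\<in>{1..opts I}. val I j > 0" using assms(1) by (simp add: sse_instance_def)
  show "expected_reward I (alg_run I x pick t) \<le> expected_reward I (alg_run I x pick (Suc t))"
    using expected_reward_step[OF log_ok_alg_run[OF assms(2)]
        online_policy_alg_rule[OF assms(2)] pos] by (simp add: Let_def)
  show "expected_reward I (alg_run I x pick t) \<le> (\<Sum>j=1..opts I. val I j)"
    by (rule expected_reward_bound[OF log_ok_alg_run[OF assms(2)] pos])
qed

end

theory Submission
  imports Defs
begin

text \<open>For the upper bound, left-compact the schedule of a policy: process the selected options in
  the same order, but without idling. Each option then starts no later than before, at a time that
  depends on the evaluation times of the earlier options only and is at most \<open>nT\<close>. So the
  probabilities that option \<open>j\<close> has compacted start time \<open>t\<close> are feasible for the linear program,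
  even if the policy profits from idling and selects options after time \<open>nT\<close>.

  For the algorithm, write \<open>m\<^sub>t = \<Sum>\<^sub>i x\<^sub>i\<^sub>,\<^sub>t\<close>. By induction, \<open>p\<^sub>j(t) f\<^sub>j\<^sub>,\<^sub>t \<ge> x\<^sub>j\<^sub>,\<^sub>t / 2 + p\<^sub>j(t) m\<^sub>t / 2\<close>,
  so that the coins of the algorithm have probabilities in \<open>[0, 1]\<close> and option \<open>j\<close> is considered
  at time \<open>t\<close> with probability exactly \<open>x\<^sub>j\<^sub>,\<^sub>t / 2\<close>. The events that different options are still
  unconsidered are dependent, but it suffices that, whatever else is known, an option not
  considered so far is unexpired with probability at most \<open>p\<^sub>j(t)\<close>. Hence at least the fraction
  \<open>1 - x\<^sub>j\<^sub>,\<^sub>t / m\<^sub>t\<close> of the expected reward from options of lower value remains when the event that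
  \<open>j\<close> is considered at time \<open>t\<close> is excluded, as if the options were considered independently with
  probabilities \<open>x\<^sub>j\<^sub>,\<^sub>t / m\<^sub>t\<close> of total \<open>1\<close>.\<close>

section \<open>Expectations along a process\<close>

text \<open>Coordinates are independent, so coordinate \<open>j\<close> may be redrawn: the value of
  \<open>f\<close> at \<open>j\<close> is overwritten by the fresh draw \<open>y\<close>.\<close>

lemma nn_integral_Pi_pmf_resample:
  assumes "finite A" "j \<in> A"
  shows "(\<integral>\<^sup>+f. F f \<partial>Pi_pmf A d p) = (\<integral>\<^sup>+y. \<integral>\<^sup>+f. F (f(j := y)) \<partial>Pi_pmf A d p \<partial>p j)"
proof -
  have *: "Pi_pmf A d p = bind_pmf (p j) (\<lambda>y. bind_pmf (Pi_pmf (A - {j}) d p)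
    (\<lambda>f. return_pmf (f(j := y))))"
    using Pi_pmf_insert'[of "A - {j}" j d p] assms by (simp add: insert_absorb)
  show ?thesis
    by (subst (1 2) *) simp
qed

lemma nn_integral_Pi_pmf_component:
  assumes "finite A" "j \<in> A"
  shows "(\<integral>\<^sup>+f. g (f j) * F (f(j := u)) \<partial>Pi_pmf A d p)
       = (\<integral>\<^sup>+y. g y \<partial>p j) * (\<integral>\<^sup>+f. F (f(j := u)) \<partial>Pi_pmf A d p)"
  by (subst nn_integral_Pi_pmf_resample[OF assms]) (simp add: nn_integral_cmult nn_integral_multc)

lemma nn_integral_step:
  "(\<integral>\<^sup>+(S', E', h', m'). \<psi> S' E' h' m' \<partial>step I t r (S, E, h, m)) =
     (if dm_free S h t
      then \<integral>\<^sup>+(a, m'). \<psi> S E (case a of None \<Rightarrow> h | Some j \<Rightarrow> (t, j) # h) m' \<partial>r (observe I t S E h) m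
      else \<psi> S E h m)"
  by (simp add: step_def case_prod_unfold cong: option.case_cong)

lemma nn_integral_initial:
  "(\<integral>\<^sup>+(S, E, h, m). \<psi> S E h m \<partial>initial I m0) =
     (\<integral>\<^sup>+S. \<integral>\<^sup>+E. \<psi> S E [] m0 \<partial>Pi_pmf {1..opts I} 0 (exp_law I) \<partial>Pi_pmf {1..opts I} 0 (eval_law I))"
  by (simp add: initial_def nn_integral_pair_pmf' case_prod_unfold)

lemma dm_free_upd: "j \<notin> selected h \<Longrightarrow> dm_free (S(j := a)) h t = dm_free S h t"
  by (force simp: dm_free_def selected_def)

text \<open>This is where the information structure enters: the evaluation time of an option is
  revealed only by selecting it, its expiration time only when it expires.\<close>

lemma observe_upd:
  "j \<notin> selected h \<Longrightarrow> E j > t \<Longrightarrow> e > t \<Longrightarrow> observe I t (S(j := a)) (E(j := e)) h = observe I t S E h"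
  by (auto simp: observe_def fun_eq_iff)

lemma selected_Cons [simp]: "selected ((t, j) # h) = insert j (selected h)"
  by (simp add: selected_def)

lemma selected_Nil [simp]: "selected [] = {}"
  by (simp add: selected_def)

text \<open>The time at which an idle-free schedule has finished the options of a log, started at time
  \<open>1\<close>.\<close>

definition compact_time :: "(nat \<Rightarrow> nat) \<Rightarrow> log \<Rightarrow> nat" where
  "compact_time S h = Suc (\<Sum>(s, j)\<leftarrow>h. S j)"

lemma compact_time_Cons [simp]: "compact_time S ((t, j) # h) = compact_time S h + S j"
  by (simp add: compact_time_def)

lemma compact_time_upd: "j \<notin> selected h \<Longrightarrow> compact_time (S(j := a)) h = compact_time S h"
  unfolding compact_time_def selected_def
    by (intro arg_cong[where f = Suc] arg_cong[where f = sum_list] map_cong) force+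

text \<open>Covers both a fixed online policy and the algorithm, whose rule varies with time because
  it depends on the law of the state through \<open>f\<^sub>j\<^sub>,\<^sub>t\<close>. The rule
  \<open>\<rho> t\<close> decides at time \<open>Suc t\<close>.\<close>

locale process =
  fixes I :: sse and T :: nat and D :: "nat \<Rightarrow> 'm state pmf" and \<rho> :: "nat \<Rightarrow> 'm rule" and m0 :: 'm
  assumes inst: "sse_instance I T"
    and D0: "D 0 = initial I m0"
    and DSuc: "D (Suc t) = bind_pmf (D t) (step I (Suc t) (\<rho> t))"
    and online: "online_policy I (\<rho> t)"
begin

lemma nn_integral_Suc:
  "(\<integral>\<^sup>+(S, E, h, m). \<psi> S E h m \<partial>D (Suc t)) =
   (\<integral>\<^sup>+(S, E, h, m). (\<integral>\<^sup>+(S', E', h', m'). \<psi> S' E' h' m' \<partial>step I (Suc t) (\<rho> t) (S, E, h, m)) \<partial>D t)"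
  by (simp add: DSuc case_prod_unfold)

text \<open>As long as option \<open>j\<close> is unselected and unexpired, its two random times have not influenced
  the process. Overwriting them by constants \<open>u\<close> and \<open>v\<close> in \<open>\<psi>\<close> expresses that \<open>\<psi>\<close> does not depend
  on them; \<open>v > t\<close> means that the constant does not let \<open>j\<close> expire.\<close>

lemma fresh:
  fixes \<psi> :: "(nat \<Rightarrow> nat) \<Rightarrow> (nat \<Rightarrow> nat) \<Rightarrow> log \<Rightarrow> 'm \<Rightarrow> ennreal"
  assumes j: "j \<in> {1..opts I}" and "v > t"
  shows "\<exists>c. \<forall>g. (\<forall>s e. e \<le> t \<longrightarrow> g s e = 0) \<longrightarrow>
    (\<integral>\<^sup>+(S, E, h, m). of_bool (j \<notin> selected h) * g (S j) (E j) * \<psi> (S(j := u)) (E(j := v)) h m \<partial>D t)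
      = c * (\<integral>\<^sup>+s. \<integral>\<^sup>+e. g s e \<partial>exp_law I j \<partial>eval_law I j)"
  using \<open>v > t\<close>
proof (induction t arbitrary: \<psi>)
  case 0
  show ?case
  proof (intro exI allI impI)
    fix g :: "nat \<Rightarrow> nat \<Rightarrow> ennreal"
    assume "\<forall>s e. e \<le> 0 \<longrightarrow> g s e = 0"
    show "(\<integral>\<^sup>+(S, E, h, m). of_bool (j \<notin> selected h) * g (S j) (E j) * \<psi> (S(j := u)) (E(j := v)) h m
      \<partial>D 0)
      = (\<integral>\<^sup>+S. \<integral>\<^sup>+E. \<psi> (S(j := u)) (E(j := v)) [] m0 \<partial>Pi_pmf {1..opts I} 0 (exp_law I)
        \<partial>Pi_pmf {1..opts I} 0 (eval_law I))
       * (\<integral>\<^sup>+s. \<integral>\<^sup>+e. g s e \<partial>exp_law I j \<partial>eval_law I j)"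
      using j
      apply (simp add: D0 nn_integral_initial)
      apply (subst nn_integral_Pi_pmf_component, simp, simp)
      apply (subst nn_integral_Pi_pmf_component, simp, simp)
      apply (simp add: mult.commute)
      done
  qed
next
  case (Suc t)
  \<comment> \<open>\<open>\<psi>'\<close> pulls the test function back through one step, together
    with the event that this step leaves \<open>j\<close> unselected. The constant \<open>c\<close>
    obtained for it is the same for all \<open>g\<close>.\<close>
  define \<psi>' where "\<psi>' S E h m = (\<integral>\<^sup>+(S', E', h', m'). of_bool (j \<notin> selected h') * \<psi> (S'(j := u))
    (E'(j := v)) h' m'
      \<partial>step I (Suc t) (\<rho> t) (S, E, h, m))" for S E h m
  have "t < v" using Suc.prems by simp
  from Suc.IH[OF this, of \<psi>'] obtain c where c: "\<forall>g. (\<forall>s e. e \<le> t \<longrightarrow> g s e = 0) \<longrightarrow>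
    (\<integral>\<^sup>+(S, E, h, m). of_bool (j \<notin> selected h) * g (S j) (E j) * \<psi>' (S(j := u)) (E(j := v)) h m \<partial>D t)
      = c * (\<integral>\<^sup>+s. \<integral>\<^sup>+e. g s e \<partial>exp_law I j \<partial>eval_law I j)" ..
  show ?case
  proof (intro exI[of _ c] allI impI)
    fix g :: "nat \<Rightarrow> nat \<Rightarrow> ennreal"
    assume g: "\<forall>s e. e \<le> Suc t \<longrightarrow> g s e = 0"
    have eq: "(\<integral>\<^sup>+(S', E', h', m'). of_bool (j \<notin> selected h') * g (S' j) (E' j) * \<psi> (S'(j := u))
      (E'(j := v)) h' m'
          \<partial>step I (Suc t) (\<rho> t) (S, E, h, m))
       = of_bool (j \<notin> selected h) * g (S j) (E j) * \<psi>' (S(j := u)) (E(j := v)) h m" for S E h m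
    \<comment> \<open>In the first case both sides vanish: a selected option stays selected, and
      \<open>g\<close> is 0 on expiration times up to \<open>Suc t\<close>. Otherwise overwriting
      the two times of \<open>j\<close> changes neither what the rule sees nor whether it may
      decide.\<close>
    proof (cases "j \<in> selected h \<or> E j \<le> Suc t")
      case True
      then show ?thesis
        by (subst nn_integral_step) (auto simp: g case_prod_unfold split: option.splits intro!:
          nn_integral_0_iff_AE[THEN iffD2])
    next
      case False
      then have "dm_free (S(j := u)) h (Suc t) = dm_free S h (Suc t)"
        "observe I (Suc t) (S(j := u)) (E(j := v)) h = observe I (Suc t) S E h"
        using Suc.prems by (simp_all add: dm_free_upd observe_upd)
      then show ?thesis using False
        unfolding \<psi>'_def nn_integral_step
        by (auto simp: case_prod_unfold nn_integral_cmult[symmetric] mult_ac intro!: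
          nn_integral_cong)
    qed
    have "(\<integral>\<^sup>+(S, E, h, m). of_bool (j \<notin> selected h) * g (S j) (E j) * \<psi> (S(j := u)) (E(j := v)) h m
      \<partial>D (Suc t))
      = (\<integral>\<^sup>+(S, E, h, m). of_bool (j \<notin> selected h) * g (S j) (E j) * \<psi>' (S(j := u)) (E(j := v)) h m
        \<partial>D t)"
      by (simp only: nn_integral_Suc eq)
    also have "\<dots> = c * (\<integral>\<^sup>+s. \<integral>\<^sup>+e. g s e \<partial>exp_law I j \<partial>eval_law I j)"
      by (rule c[rule_format]) (use g in auto)
    finally show "(\<integral>\<^sup>+(S, E, h, m). of_bool (j \<notin> selected h) * g (S j) (E j) * \<psi> (S(j := u))
      (E(j := v)) h m \<partial>D (Suc t))
      = c * (\<integral>\<^sup>+s. \<integral>\<^sup>+e. g s e \<partial>exp_law I j \<partial>eval_law I j)" .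
  qed
qed

text \<open>The constant \<open>c\<close> does not depend on \<open>P\<close> and \<open>s\<close>.
  Comparing two choices of them eliminates \<open>c\<close> and yields conditional probabilities
  without division.\<close>

lemma fresh_factor:
  fixes \<psi> :: "(nat \<Rightarrow> nat) \<Rightarrow> (nat \<Rightarrow> nat) \<Rightarrow> log \<Rightarrow> 'm \<Rightarrow> ennreal"
  assumes j: "j \<in> {1..opts I}" and "t \<le> \<theta>"
    and \<psi>: "\<And>S E h m a e. j \<notin> selected h \<Longrightarrow> E j > \<theta> \<Longrightarrow> e > \<theta> \<Longrightarrow> \<psi> (S(j := a)) (E(j := e)) h m
      = \<psi> S E h m"
  obtains c where "\<And>P s. s \<ge> \<theta> \<Longrightarrow>
    (\<integral>\<^sup>+(S, E, h, m). of_bool (j \<notin> selected h \<and> P (S j) \<and> E j > s) * \<psi> S E h m \<partial>D t)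
      = c * ennreal (measure_pmf.prob (eval_law I j) {a. P a} * surv I j s)"
proof -
  have "t < Suc \<theta>" using \<open>t \<le> \<theta>\<close> by simp
  from fresh[OF j this, where u = 0 and \<psi> = \<psi>] obtain c where c: "\<forall>g. (\<forall>s e. e \<le> t \<longrightarrow> g s e = 0) \<longrightarrow>
    (\<integral>\<^sup>+(S, E, h, m). of_bool (j \<notin> selected h) * g (S j) (E j) * \<psi> (S(j := 0)) (E(j := Suc \<theta>)) h m
      \<partial>D t)
      = c * (\<integral>\<^sup>+s. \<integral>\<^sup>+e. g s e \<partial>exp_law I j \<partial>eval_law I j)" ..
  show thesis
  proof (rule that)
    fix P :: "nat \<Rightarrow> bool" and s assume s: "s \<ge> \<theta>"
    define g :: "nat \<Rightarrow> nat \<Rightarrow> ennreal" where "g a e = of_bool (P a) * of_bool (e > s)" for a e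
    have "(\<integral>\<^sup>+(S, E, h, m). of_bool (j \<notin> selected h \<and> P (S j) \<and> E j > s) * \<psi> S E h m \<partial>D t)
      = (\<integral>\<^sup>+(S, E, h, m). of_bool (j \<notin> selected h) * g (S j) (E j) * \<psi> (S(j := 0)) (E(j := Suc \<theta>)) h
        m \<partial>D t)"
      using s by (intro nn_integral_cong) (auto simp: g_def \<psi>)
    also have "\<dots> = c * (\<integral>\<^sup>+s. \<integral>\<^sup>+e. g s e \<partial>exp_law I j \<partial>eval_law I j)"
      by (rule c[rule_format]) (use s \<open>t \<le> \<theta>\<close> in \<open>auto simp: g_def\<close>)
    also have "(\<integral>\<^sup>+s. \<integral>\<^sup>+e. g s e \<partial>exp_law I j \<partial>eval_law I j)
       = (\<integral>\<^sup>+s. indicator {a. P a} s \<partial>eval_law I j) * (\<integral>\<^sup>+e. indicator {e. e > s} e \<partial>exp_law I j)"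
      by (simp add: g_def nn_integral_cmult nn_integral_multc indicator_def of_bool_def del:
        nn_integral_indicator)
    also have "\<dots> = ennreal (measure_pmf.prob (eval_law I j) {a. P a} * surv I j s)"
      by (simp add: measure_pmf.emeasure_eq_measure surv_def ennreal_mult')
    finally show "(\<integral>\<^sup>+(S, E, h, m). of_bool (j \<notin> selected h \<and> P (S j) \<and> E j > s) * \<psi> S E h m \<partial>D t)
      = c * ennreal (measure_pmf.prob (eval_law I j) {a. P a} * surv I j s)" .
  qed
qed


section \<open>The linear program bounds every online policy\<close>

text \<open>The last conjunct says that idling only delays: whenever the decision-maker is free, the
  compacted schedule is finished too. It is restricted to \<open>t \<ge> 1\<close> because the
  compacted schedule starts at time 1.\<close>

definition valid_log :: "(nat \<Rightarrow> nat) \<Rightarrow> log \<Rightarrow> bool" where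
  "valid_log S h \<longleftrightarrow> distinct (map snd h) \<and> selected h \<subseteq> {1..opts I} \<and> (\<forall>k\<in>{1..opts I}. 1 \<le> S k \<and> S k
    \<le> T)
     \<and> (\<forall>t\<ge>1. dm_free S h t \<longrightarrow> compact_time S h \<le> t)"

lemma eval_law_bounds:
  assumes "k \<in> {1..opts I}" "s \<in> set_pmf (eval_law I k)"
  shows "1 \<le> s \<and> s \<le> T"
proof -
  have "Fbar I k T = 0" "set_pmf (eval_law I k) \<subseteq> {1..}"
    using inst assms by (auto simp: sse_instance_def)
  then have "set_pmf (eval_law I k) \<inter> {s. s > T} = {}"
    by (simp add: Fbar_def measure_pmf_zero_iff)
  then show ?thesis using assms \<open>set_pmf (eval_law I k) \<subseteq> {1..}\<close> by force
qed

lemma Fbar_0: "k \<in> {1..opts I} \<Longrightarrow> Fbar I k 0 = 1"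
  using eval_law_bounds[of k] by (force simp: Fbar_def measure_pmf.prob_eq_1 AE_measure_pmf_iff)

lemma rule_range:
  assumes "(a, m') \<in> set_pmf (\<rho> t (observe I t' S E h) m)"
  shows "a = None \<or> (\<exists>j\<in>{1..opts I}. a = Some j \<and> j \<notin> selected h \<and> E j > t')"
proof -
  have "a = None \<or> (\<exists>j\<in>available I (observe I t' S E h). a = Some j)"
    using online[of t] assms unfolding online_policy_def by blast
  then show ?thesis by (auto simp: available_def observe_def split: if_splits)
qed

lemma valid_log_run: "(S, E, h, m) \<in> set_pmf (D t) \<Longrightarrow> valid_log S h"
proof (induction t arbitrary: S E h m)
  case 0
  then have h: "h = []" and S: "S \<in> set_pmf (Pi_pmf {1..opts I} 0 (eval_law I))"
    by (auto simp: D0 initial_def)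
  have "S k \<in> set_pmf (eval_law I k)" if "k \<in> {1..opts I}" for k
    using S that by (auto simp: set_Pi_pmf PiE_dflt_def)
  then show ?case using h eval_law_bounds by (auto simp: valid_log_def compact_time_def)
next
  case (Suc t)
  then obtain S0 E0 h0 k0 where 0: "(S0, E0, h0, k0) \<in> set_pmf (D t)"
    and 1: "(S, E, h, m) \<in> set_pmf (step I (Suc t) (\<rho> t) (S0, E0, h0, k0))"
    by (auto simp: DSuc)
  have v: "valid_log S0 h0" using Suc.IH 0 .
  have "S = S0" "E = E0" using 1 by (auto simp: step_def split: if_splits)
  consider "h = h0" | j where "j \<in> {1..opts I}" "j \<notin> selected h0" "h
    = (Suc t, j) # h0" "dm_free S h0 (Suc t)"
    using 1 rule_range[of _ _ t "Suc t" S0 E0 h0 k0]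
    by (fastforce simp: step_def split: if_splits option.splits)
  then show ?case
  proof cases
    case 1
    then show ?thesis using v \<open>S = S0\<close> by simp
  next
    case 2
    have "compact_time S h0 \<le> Suc t" using v 2 \<open>S = S0\<close> by (auto simp: valid_log_def)
    then show ?thesis using v 2 \<open>S = S0\<close> by (auto simp: valid_log_def dm_free_def selected_def)
  qed
qed

text \<open>The conditional probability, given the state before time \<open>t + 1\<close>, of selecting \<open>i\<close> at time
  \<open>t + 1\<close>. All quantities of a process indexed by \<open>t\<close> refer to the decision at time \<open>t + 1\<close>.\<close>

definition sel_prob :: "nat \<Rightarrow> nat \<Rightarrow> (nat \<Rightarrow> nat) \<Rightarrow> (nat \<Rightarrow> nat) \<Rightarrow> log \<Rightarrow> 'm \<Rightarrow> ennreal" where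
  "sel_prob i t S E h m = of_bool (dm_free S h (Suc t)) *
     emeasure (measure_pmf (\<rho> t (observe I (Suc t) S E h) m)) {(a, m'). a = Some i}"

lemma sel_prob_eq_0: "i \<in> selected h \<or> E i \<le> Suc t \<or> i \<notin> {1..opts I} \<Longrightarrow> sel_prob i t S E h m = 0"
proof -
  assume *: "i \<in> selected h \<or> E i \<le> Suc t \<or> i \<notin> {1..opts I}"
  have "set_pmf (\<rho> t (observe I (Suc t) S E h) m) \<inter> {(a, m'). a = Some i} = {}"
    using * by (fastforce dest: rule_range)
  then show ?thesis by (simp add: sel_prob_def measure_pmf.emeasure_eq_measure measure_pmf_zero_iff)
qed

lemma sel_prob_upd:
  assumes "i \<notin> selected h" "E i > Suc t" "e > Suc t"
  shows "sel_prob i t (S(i := a)) (E(i := e)) h m = sel_prob i t S E h m"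
  using assms by (simp add: sel_prob_def dm_free_upd observe_upd)

text \<open>At most one option is selected at a time, so the increments add up, each weighted by its
  selection probability.\<close>

lemma nn_integral_step_increment:
  fixes \<phi> :: "(nat \<Rightarrow> nat) \<Rightarrow> (nat \<Rightarrow> nat) \<Rightarrow> log \<Rightarrow> ennreal"
  assumes "\<And>i. i \<in> {1..opts I} \<Longrightarrow> \<phi> S E ((Suc t, i) # h) = \<phi> S E h + \<delta> i"
  shows "(\<integral>\<^sup>+(S', E', h', m'). \<phi> S' E' h' \<partial>step I (Suc t) (\<rho> t) (S, E, h, m))
       = \<phi> S E h + (\<Sum>i=1..opts I. \<delta> i * sel_prob i t S E h m)"
proof (cases "dm_free S h (Suc t)")
  case False
  then show ?thesis by (subst nn_integral_step) (simp add: sel_prob_def)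
next
  case True
  let ?R = "\<rho> t (observe I (Suc t) S E h) m"
  have "(\<integral>\<^sup>+(S', E', h', m'). \<phi> S' E' h' \<partial>step I (Suc t) (\<rho> t) (S, E, h, m))
      = (\<integral>\<^sup>+(a, m'). \<phi> S E (case a of None \<Rightarrow> h | Some j \<Rightarrow> (Suc t, j) # h) \<partial>?R)"
    using True by (subst nn_integral_step) simp
  also have "\<dots> = (\<integral>\<^sup>+w. \<phi> S E h + (\<Sum>i=1..opts I. \<delta> i * indicator {(a, m'). a = Some i} w) \<partial>?R)"
  proof (intro nn_integral_cong_AE, unfold AE_measure_pmf_iff, clarify)
    fix a m' assume "(a, m') \<in> set_pmf ?R"
    then consider "a = None" | j where "j \<in> {1..opts I}" "a = Some j" using rule_range by blast
    then show "\<phi> S E (case a of None \<Rightarrow> h | Some j \<Rightarrow> (Suc t, j) # h)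
        = \<phi> S E h + (\<Sum>i=1..opts I. \<delta> i * indicator {(a, m'). a = Some i} (a, m'))"
    proof cases
      case 2
      then have "(\<Sum>i=1..opts I. \<delta> i * indicator {(a, m'). a = Some i} (a, m')) = (\<Sum>i=1..opts I. if i
        = j then \<delta> i else 0)"
        by (intro sum.cong) (auto simp: indicator_def)
      then show ?thesis using 2 assms by simp
    qed simp
  qed
  also have "\<dots> = \<phi> S E h + (\<Sum>i=1..opts I. \<delta> i * sel_prob i t S E h m)"
    using True by (simp add: nn_integral_add nn_integral_sum nn_integral_cmult sel_prob_def del:
      sum_mult_indicator)
  finally show ?thesis .
qed

lemma nn_integral_Suc_increment:
  fixes \<phi> :: "(nat \<Rightarrow> nat) \<Rightarrow> (nat \<Rightarrow> nat) \<Rightarrow> log \<Rightarrow> ennreal"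
  assumes "\<And>S E h i. i \<in> {1..opts I} \<Longrightarrow> \<phi> S E ((Suc t, i) # h) = \<phi> S E h + \<delta> S E h i"
  shows "(\<integral>\<^sup>+(S, E, h, m). \<phi> S E h \<partial>D (Suc t))
       = (\<integral>\<^sup>+(S, E, h, m). \<phi> S E h \<partial>D t)
       + (\<Sum>i=1..opts I. \<integral>\<^sup>+(S, E, h, m). \<delta> S E h i * sel_prob i t S E h m \<partial>D t)"
proof -
  have *: "(\<integral>\<^sup>+(S', E', h', m'). \<phi> S' E' h' \<partial>step I (Suc t) (\<rho> t) (S, E, h, m))
      = \<phi> S E h + (\<Sum>i=1..opts I. \<delta> S E h i * sel_prob i t S E h m)" for S E h m
    by (rule nn_integral_step_increment) (rule assms)
  have "(\<integral>\<^sup>+(S, E, h, m). \<phi> S E h \<partial>D (Suc t))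
      = (\<integral>\<^sup>+(S, E, h, m). \<phi> S E h + (\<Sum>i=1..opts I. \<delta> S E h i * sel_prob i t S E h m) \<partial>D t)"
    by (simp only: nn_integral_Suc *)
  then show ?thesis by (simp add: case_prod_unfold nn_integral_add nn_integral_sum)
qed

text \<open>Given the selection of \<open>i\<close> at time \<open>Suc t\<close> and the earlier
  history in \<open>\<xi>\<close>, the evaluation time of \<open>i\<close> and its survival beyond
  \<open>Suc t\<close> still follow the original laws, independently. The identity is
  cross-multiplied: both integrals come from \<open>fresh_factor\<close> with the same
  constant.\<close>

lemma sel_prob_fresh:
  assumes "i \<in> {1..opts I}"
    and \<xi>: "\<And>S h a. i \<notin> selected h \<Longrightarrow> \<xi> (S(i := a)) h = \<xi> S h"
    and s: "s \<ge> Suc t" "s' \<ge> Suc t"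
  shows "ennreal (surv I i s') * (\<integral>\<^sup>+(S, E, h, m). of_bool (S i > a \<and> E i > s) * \<xi> S h * sel_prob i t
    S E h m \<partial>D t)
      = ennreal (Fbar I i a * surv I i s) * (\<integral>\<^sup>+(S, E, h, m). of_bool (E i > s') * \<xi> S h
        * sel_prob i t S E h m \<partial>D t)"
proof -
  obtain c where c: "\<And>P s. s \<ge> Suc t \<Longrightarrow>
    (\<integral>\<^sup>+(S, E, h, m). of_bool (i \<notin> selected h \<and> P (S i) \<and> E i > s) * (\<xi> S h * sel_prob i t S E h m)
      \<partial>D t)
      = c * ennreal (measure_pmf.prob (eval_law I i) {a. P a} * surv I i s)"
    by (rule fresh_factor[OF assms(1), of t "Suc t" "\<lambda>S E h m. \<xi> S h * sel_prob i t S E h m"])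
       (auto simp: \<xi> sel_prob_upd)
  have *: "(\<integral>\<^sup>+(S, E, h, m). of_bool (P (S i) \<and> E i > s) * \<xi> S h * sel_prob i t S E h m \<partial>D t)
     = c * ennreal (measure_pmf.prob (eval_law I i) {a. P a} * surv I i s)" if "s \<ge> Suc t" for s P
    unfolding c[OF that, symmetric] by (intro nn_integral_cong) (auto simp: sel_prob_eq_0)
  show ?thesis
    using *[OF s(1), of "\<lambda>x. x > a"] *[OF s(2), of "\<lambda>_. True"]
    by (simp add: Fbar_def ennreal_mult' surv_def mult_ac)
qed

section \<open>The expiration constraint at the actual selection times\<close>

lemma surv_pos: "i \<in> {1..opts I} \<Longrightarrow> surv I i t > 0"
proof -
  assume i: "i \<in> {1..opts I}"
  have "surv I i (max 1 t) > 0" using inst i by (auto simp: sse_instance_def)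
  moreover have "surv I i (max 1 t) \<le> surv I i t"
    unfolding surv_def by (intro measure_pmf.finite_measure_mono) auto
  ultimately show ?thesis by simp
qed

lemma surv_antimono: "s \<le> t \<Longrightarrow> surv I i t \<le> surv I i s"
  unfolding surv_def by (intro measure_pmf.finite_measure_mono) auto

lemma exp_marginal:
  assumes "i \<in> {1..opts I}"
  shows "(\<integral>\<^sup>+(S, E, h, m). of_bool (E i > s) \<partial>D t) = surv I i s"
proof (induction t)
  case 0
  have "(\<integral>\<^sup>+E. of_bool (E i > s) * 1 \<partial>Pi_pmf {1..opts I} 0 (exp_law I))
    = (\<integral>\<^sup>+e. of_bool (e > s) \<partial>exp_law I i)"
    by (subst nn_integral_Pi_pmf_component[where F = "\<lambda>_. 1" and g = "\<lambda>e. of_bool (e > s)"])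
       (use assms in simp_all)
  also have "\<dots> = (\<integral>\<^sup>+e. indicator {e. e > s} e \<partial>exp_law I i)"
    by (intro nn_integral_cong) (auto simp: indicator_def)
  finally have "(\<integral>\<^sup>+E. of_bool (E i > s) * 1 \<partial>Pi_pmf {1..opts I} 0 (exp_law I))
    = (\<integral>\<^sup>+e. indicator {e. e > s} e \<partial>exp_law I i)" .
  then show ?case
    unfolding D0 nn_integral_initial by (simp add: surv_def measure_pmf.emeasure_eq_measure)
next
  case (Suc t)
  have "(\<integral>\<^sup>+(S, E, h, m). of_bool (E i > s) \<partial>D (Suc t)) = (\<integral>\<^sup>+(S, E, h, m). of_bool (E i > s) \<partial>D t)"
    by (subst nn_integral_Suc_increment[where \<delta> = "\<lambda>_ _ _ _. 0"]) (simp_all add: case_prod_unfold)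
  with Suc show ?case by (simp add: case_prod_unfold)
qed

lemma sum_sel_prob:
  assumes i: "i \<in> {1..opts I}"
  shows "(\<integral>\<^sup>+(S, E, h, m). of_bool (i \<in> selected h \<and> E i > s) \<partial>D L)
     = (\<Sum>t<L. \<integral>\<^sup>+(S, E, h, m). of_bool (E i > s) * sel_prob i t S E h m \<partial>D t)"
proof (induction L)
  case 0
  then show ?case by (simp add: D0 nn_integral_initial)
next
  case (Suc L)
  have "(\<integral>\<^sup>+(S, E, h, m). of_bool (i \<in> selected h \<and> E i > s) \<partial>D (Suc L))
     = (\<integral>\<^sup>+(S, E, h, m). of_bool (i \<in> selected h \<and> E i > s) \<partial>D L)
       + (\<Sum>k=1..opts I. \<integral>\<^sup>+(S, E, h, m). of_bool (k = i \<and> i \<notin> selected h \<and> E i > s) * sel_prob k L S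
         E h m \<partial>D L)"
    by (rule nn_integral_Suc_increment) auto
  also have "(\<Sum>k=1..opts I. \<integral>\<^sup>+(S, E, h, m). of_bool (k = i \<and> i \<notin> selected h \<and> E i > s)
    * sel_prob k L S E h m \<partial>D L)
      = (\<Sum>k=1..opts I. if k = i then \<integral>\<^sup>+(S, E, h, m). of_bool (E i > s) * sel_prob i L S E h m
        \<partial>D L else 0)"
    by (intro sum.cong refl) (auto simp: sel_prob_eq_0 of_bool_def case_prod_unfold intro!:
      nn_integral_cong)
  finally show ?case using Suc i by simp
qed

text \<open>Selecting \<open>i\<close> at time \<open>Suc t\<close> and having
  \<open>E i > L\<close> has probability \<open>surv I i L / surv I i (Suc t)\<close> times that of
  the selection. For different \<open>t\<close> these events are disjoint and contained in
  \<open>E i > L\<close>, whose probability \<open>surv I i L\<close> cancels.\<close>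

lemma sum_sel_prob_surv_le_1:
  assumes i: "i \<in> {1..opts I}"
  shows "(\<Sum>t<L. ennreal (1 / surv I i (Suc t)) * (\<integral>\<^sup>+(S, E, h, m). sel_prob i t S E h m \<partial>D t)) \<le> 1"
proof -
  let ?Q = "\<lambda>t. \<integral>\<^sup>+(S, E, h, m). sel_prob i t S E h m \<partial>D t"
  have eq: "(\<integral>\<^sup>+(S, E, h, m). of_bool (E i > L) * sel_prob i t S E h m \<partial>D t)
     = ennreal (surv I i L) * (ennreal (1 / surv I i (Suc t)) * ?Q t)" if t: "t < L" for t
  proof -
    have 1: "(\<integral>\<^sup>+(S, E, h, m). of_bool (E i > Suc t) * sel_prob i t S E h m \<partial>D t) = ?Q t"
      by (intro nn_integral_cong) (auto simp: sel_prob_eq_0)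
    have 2: "(\<integral>\<^sup>+(S, E, h, m). of_bool (S i > 0 \<and> E i > L) * sel_prob i t S E h m \<partial>D t)
       = (\<integral>\<^sup>+(S, E, h, m). of_bool (E i > L) * sel_prob i t S E h m \<partial>D t)"
    proof (intro nn_integral_cong_AE, unfold AE_measure_pmf_iff, clarify)
      fix S E h m assume "(S, E, h, m) \<in> set_pmf (D t)"
      from valid_log_run[OF this] i have "S i > 0" by (force simp: valid_log_def)
      then show "of_bool (S i > 0 \<and> E i > L) * sel_prob i t S E h m
        = of_bool (E i > L) * sel_prob i t S E h m"
        by simp
    qed
    have "ennreal (surv I i (Suc t)) * (\<integral>\<^sup>+(S, E, h, m). of_bool (E i > L) * sel_prob i t S E h m
      \<partial>D t)
        = ennreal (surv I i L) * ?Q t"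
      using sel_prob_fresh[OF i, of "\<lambda>_ _. 1" t L "Suc t" 0] t by (simp add: 1 2 Fbar_0[OF i])
    then have "ennreal (1 / surv I i (Suc t)) * ennreal (surv I i (Suc t))
      * (\<integral>\<^sup>+(S, E, h, m). of_bool (E i > L) * sel_prob i t S E h m \<partial>D t)
        = ennreal (1 / surv I i (Suc t)) * (ennreal (surv I i L) * ?Q t)"
      by (simp only: mult.assoc)
    moreover have "ennreal (1 / surv I i (Suc t)) * ennreal (surv I i (Suc t)) = 1"
      using surv_pos[OF i, of "Suc t"] by (simp flip: ennreal_mult)
    ultimately have "(\<integral>\<^sup>+(S, E, h, m). of_bool (E i > L) * sel_prob i t S E h m \<partial>D t)
        = ennreal (1 / surv I i (Suc t)) * (ennreal (surv I i L) * ?Q t)"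
          by (simp only: mult_1_left)
    then show ?thesis by (simp only: mult.left_commute)
  qed
  have "ennreal (surv I i L) * (\<Sum>t<L. ennreal (1 / surv I i (Suc t)) * ?Q t)
      = (\<integral>\<^sup>+(S, E, h, m). of_bool (i \<in> selected h \<and> E i > L) \<partial>D L)"
    unfolding sum_sel_prob[OF i] by (simp add: sum_distrib_left eq)
  also have "\<dots> \<le> (\<integral>\<^sup>+(S, E, h, m). of_bool (E i > L) \<partial>D L)"
    by (intro nn_integral_mono) auto
  also have "\<dots> = ennreal (surv I i L) * 1" using exp_marginal[OF i] by simp
  finally show ?thesis
    using surv_pos[OF i, of L] by (subst (asm) ennreal_mult_le_mult_iff) auto
qed

text \<open>The probability that \<open>i\<close> is selected by time \<open>L\<close> with
  compacted start time \<open>c\<close>, split by the actual selection time. It is the candidate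
  solution of the linear program.\<close>

definition compact_sel_prob :: "nat \<Rightarrow> nat \<Rightarrow> nat \<Rightarrow> ennreal" where
  "compact_sel_prob L i c = (\<Sum>t<L. \<integral>\<^sup>+(S, E, h, m). of_bool (compact_time S h = c) * sel_prob i t S E
    h m \<partial>D t)"

text \<open>The intervals in which the options of a log are processed without idling tile
  \<open>[1, compact_time S h)\<close>, so at most one of them contains \<open>\<theta>\<close>.\<close>

lemma sum_Fbar_compact_sel_prob:
  assumes "\<theta> \<ge> 1"
  shows "(\<Sum>i=1..opts I. \<Sum>c=1..\<theta>. ennreal (Fbar I i (\<theta> - c)) * compact_sel_prob L i c)
     = (\<integral>\<^sup>+(S, E, h, m). of_bool (\<theta> < compact_time S h) \<partial>D L)"
proof (induction L)
  case 0
  then show ?case unfolding D0 nn_integral_initial using assms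
    by (simp add: compact_sel_prob_def compact_time_def)
next
  case (Suc L)
  \<comment> \<open>Selecting \<open>i\<close> covers \<open>\<theta>\<close> iff the new interval
    contains \<open>\<theta>\<close>. For a given start \<open>c\<close> this means
    \<open>S i > \<theta> - c\<close>, and \<open>S i\<close> is independent of the start.\<close>
  have eq: "(\<integral>\<^sup>+(S, E, h, m). of_bool (compact_time S h \<le> \<theta> \<and> \<theta> < compact_time S h + S i)
    * sel_prob i L S E h m \<partial>D L)
     = (\<Sum>c=1..\<theta>. ennreal (Fbar I i (\<theta> - c)) * (\<integral>\<^sup>+(S, E, h, m). of_bool (compact_time S h = c)
       * sel_prob i L S E h m \<partial>D L))"
    if i: "i \<in> {1..opts I}" for i
  proof -
    have 1: "(\<integral>\<^sup>+(S, E, h, m). of_bool (S i > \<theta> - c \<and> E i > Suc L) * of_bool (compact_time S h = c)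
      * sel_prob i L S E h m \<partial>D L)
        = ennreal (Fbar I i (\<theta> - c)) * (\<integral>\<^sup>+(S, E, h, m). of_bool (compact_time S h = c)
          * sel_prob i L S E h m \<partial>D L)" for c
    proof -
      let ?p = "ennreal (surv I i (Suc L))" and ?F = "ennreal (Fbar I i (\<theta> - c))"
      let ?A = "\<integral>\<^sup>+(S, E, h, m). of_bool (S i > \<theta> - c \<and> E i > Suc L) * of_bool (compact_time S h = c)
        * sel_prob i L S E h m \<partial>D L"
      let ?B = "\<integral>\<^sup>+(S, E, h, m). of_bool (compact_time S h = c) * sel_prob i L S E h m \<partial>D L"
      have "(\<integral>\<^sup>+(S, E, h, m). of_bool (E i > Suc L) * of_bool (compact_time S h = c) * sel_prob i L S
        E h m \<partial>D L) = ?B"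
        by (intro nn_integral_cong) (auto simp: sel_prob_eq_0)
      then have "?p * ?A = ennreal (Fbar I i (\<theta> - c) * surv I i (Suc L)) * ?B"
        using sel_prob_fresh[OF i, of "\<lambda>S h. of_bool (compact_time S h = c)" L "Suc L" "Suc L" "\<theta> -
          c"] by (simp add: compact_time_upd)
      also have "\<dots> = ?p * (?F * ?B)"
        by (simp add: ennreal_mult Fbar_def surv_def mult_ac)
      finally show ?thesis
        using surv_pos[OF i, of "Suc L"] by (simp add: ennreal_mult_cancel_left)
    qed
    have "(\<integral>\<^sup>+(S, E, h, m). of_bool (compact_time S h \<le> \<theta> \<and> \<theta> < compact_time S h + S i)
      * sel_prob i L S E h m \<partial>D L)
      = (\<integral>\<^sup>+(S, E, h, m). (\<Sum>c=1..\<theta>. of_bool (S i > \<theta> - c \<and> E i > Suc L) * of_bool (compact_time S h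
        = c) * sel_prob i L S E h m) \<partial>D L)"
    proof (intro nn_integral_cong, clarify)
      fix S E h m
      have "(\<Sum>c=1..\<theta>. of_bool (S i > \<theta> - c \<and> E i > Suc L) * of_bool (compact_time S h = c)
        * sel_prob i L S E h m)
         = (\<Sum>c=1..\<theta>. if c = compact_time S h then of_bool (S i > \<theta> - c) * sel_prob i L S E h m else
           0)"
        by (intro sum.cong) (auto simp: sel_prob_eq_0)
      then show "of_bool (compact_time S h \<le> \<theta> \<and> \<theta> < compact_time S h + S i) * sel_prob i L S E h m
         = (\<Sum>c=1..\<theta>. of_bool (S i > \<theta> - c \<and> E i > Suc L) * of_bool (compact_time S h = c)
           * sel_prob i L S E h m)"
        by (auto simp: compact_time_def)
    qed
    also have "\<dots> = (\<Sum>c=1..\<theta>. \<integral>\<^sup>+(S, E, h, m). of_bool (S i > \<theta> - c \<and> E i > Suc L)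
      * of_bool (compact_time S h = c) * sel_prob i L S E h m \<partial>D L)"
      by (simp add: case_prod_unfold nn_integral_sum)
    finally show ?thesis by (simp only: 1)
  qed
  have "(\<integral>\<^sup>+(S, E, h, m). of_bool (\<theta> < compact_time S h) \<partial>D (Suc L))
     = (\<integral>\<^sup>+(S, E, h, m). of_bool (\<theta> < compact_time S h) \<partial>D L)
      + (\<Sum>i=1..opts I. \<integral>\<^sup>+(S, E, h, m). of_bool (compact_time S h \<le> \<theta> \<and> \<theta> < compact_time S h + S i)
        * sel_prob i L S E h m \<partial>D L)"
    by (rule nn_integral_Suc_increment) auto
  then show ?case
    by (simp add: eq Suc.IH[symmetric] compact_sel_prob_def distrib_left sum.distrib)
qed

text \<open>While \<open>i\<close> is unselected, at most \<open>n - 1\<close> options of length at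
  most \<open>T\<close> precede it, so its compacted start is at most \<open>1 + (n - 1) T\<close>,
  hence at most \<open>nT\<close> because \<open>T \<ge> 1\<close>.\<close>

lemma compact_time_le:
  assumes v: "valid_log S h" and i: "i \<in> {1..opts I}" "i \<notin> selected h"
  shows "compact_time S h \<le> opts I * T"
proof -
  have "(\<Sum>(s, j)\<leftarrow>h. S j) = sum_list (map S (map snd h))"
    by (simp add: case_prod_unfold comp_def)
  also have "\<dots> = sum S (selected h)"
    by (subst sum_list_distinct_conv_sum_set) (use v in \<open>auto simp: valid_log_def selected_def\<close>)
  also have "\<dots> \<le> (\<Sum>j\<in>{1..opts I} - {i}. T)"
  proof -
    have "sum S (selected h) \<le> sum S ({1..opts I} - {i})"
      by (rule sum_mono2) (use v i in \<open>auto simp: valid_log_def\<close>)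
    also have "\<dots> \<le> (\<Sum>j\<in>{1..opts I} - {i}. T)"
      by (rule sum_mono) (use v in \<open>auto simp: valid_log_def\<close>)
    finally show ?thesis .
  qed
  also have "\<dots> = (opts I - 1) * T" using i by simp
  finally have "compact_time S h \<le> Suc ((opts I - 1) * T)" by (simp add: compact_time_def)
  moreover have "T \<ge> 1" using v i unfolding valid_log_def by force
  moreover have "opts I * T = (opts I - 1) * T + T" using i by (cases "opts I") auto
  ultimately show ?thesis by simp
qed

text \<open>Puts the bounds on the compacted start into the indicator, where they can be used
  pointwise: it lies between 1 and \<open>nT\<close> and is no later than the actual selection
  time.\<close>

lemma compact_sel_prob_eq: "compact_sel_prob L i c = (\<Sum>t<L. \<integral>\<^sup>+(S, E, h, m). of_bool (c \<le> Suc t \<and> 1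
  \<le> c \<and> c \<le> opts I * T \<and> compact_time S h = c) * sel_prob i t S E h m \<partial>D t)"
  unfolding compact_sel_prob_def
proof (intro sum.cong refl nn_integral_cong_AE, unfold AE_measure_pmf_iff, clarify)
  fix t S E h m assume "(S, E, h, m) \<in> set_pmf (D t)"
  then have v: "valid_log S h" by (rule valid_log_run)
  show "of_bool (compact_time S h = c) * sel_prob i t S E h m = of_bool (c \<le> Suc t \<and> 1 \<le> c \<and> c
    \<le> opts I * T \<and> compact_time S h = c) * sel_prob i t S E h m"
  proof (cases "i \<in> selected h \<or> i \<notin> {1..opts I} \<or> \<not> dm_free S h (Suc t)")
    case True
    then have "sel_prob i t S E h m = 0" by (auto simp: sel_prob_eq_0) (simp add: sel_prob_def)
    then show ?thesis by simp
  next
    case False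
    then show ?thesis using v compact_time_le[OF v] by (auto simp: valid_log_def compact_time_def)
  qed
qed

lemma sum_compact_sel_prob:
  assumes i: "i \<in> {1..opts I}"
  shows "(\<Sum>c=1..opts I * T. compact_sel_prob L i c)
    = ennreal (measure_pmf.prob (D L) {(S, E, h, m). i \<in> selected h})"
proof -
  have "(\<Sum>c=1..opts I * T. compact_sel_prob L i c)
    = (\<Sum>t<L. \<integral>\<^sup>+(S, E, h, m). (\<Sum>c=1..opts I * T. of_bool (compact_time S h = c) * sel_prob i t S E h
    m) \<partial>D t)"
    unfolding compact_sel_prob_def case_prod_unfold
      by (subst sum.swap) (intro sum.cong refl nn_integral_sum[symmetric], simp)
  also have "\<dots> = (\<Sum>t<L. \<integral>\<^sup>+(S, E, h, m). of_bool (E i > 0) * sel_prob i t S E h m \<partial>D t)"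
  proof (intro sum.cong refl nn_integral_cong_AE, unfold AE_measure_pmf_iff, clarify)
    fix t S E h m assume "(S, E, h, m) \<in> set_pmf (D t)"
    then have v: "valid_log S h" by (rule valid_log_run)
    have "(\<Sum>c=1..opts I * T. of_bool (compact_time S h = c) * sel_prob i t S E h m)
       = (\<Sum>c=1..opts I * T. if c = compact_time S h then sel_prob i t S E h m else 0)"
      by (intro sum.cong) auto
    then show "(\<Sum>c=1..opts I * T. of_bool (compact_time S h = c) * sel_prob i t S E h m)
      = of_bool (E i > 0) * sel_prob i t S E h m"
      using compact_time_le[OF v i] by (cases "i \<in> selected h")
        (auto simp: sel_prob_eq_0 compact_time_def)
  qed
  also have "\<dots> = (\<integral>\<^sup>+(S, E, h, m). of_bool (i \<in> selected h \<and> E i > 0) \<partial>D L)"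
    by (rule sum_sel_prob[OF i, symmetric])
  also have "\<dots> = (\<integral>\<^sup>+w. indicator {(S, E, h, m). i \<in> selected h} w \<partial>D L)"
  proof (intro nn_integral_cong_AE)
    have E: "AE w in D L. case w of (S, E, h, m) \<Rightarrow> E i > 0"
    proof -
      have "(\<integral>\<^sup>+w. indicator {(S, E, h, m). E i > 0} w \<partial>D L) = (\<integral>\<^sup>+(S, E, h, m). of_bool (E i > 0)
        \<partial>D L)"
        by (intro nn_integral_cong) (auto simp: indicator_def)
      also have "\<dots> = surv I i 0" by (rule exp_marginal[OF i])
      also have "surv I i 0 = 1"
        using inst i unfolding surv_def sse_instance_def
        by (force simp: measure_pmf.prob_eq_1 AE_measure_pmf_iff)
      finally have "measure_pmf.prob (D L) {(S, E, h, m). E i > 0} = 1"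
        by (simp add: measure_pmf.emeasure_eq_measure case_prod_unfold)
      then have "AE w in D L. w \<in> {(S, E, h, m). E i > 0}"
        by (subst measure_pmf.prob_eq_1[symmetric]) simp_all
      then show ?thesis by eventually_elim auto
    qed
    then show "AE w in D L. (case w of (S, E, h, m) \<Rightarrow> of_bool (i \<in> selected h \<and> E i > 0))
      = (indicator {(S, E, h, m). i \<in> selected h} w :: ennreal)"
      by eventually_elim (auto simp: indicator_def)
  qed
  finally show ?thesis by (simp add: measure_pmf.emeasure_eq_measure)
qed

lemma expected_reward_eq:
  "expected_reward I (D L) = (\<Sum>i=1..opts I. val I i * measure_pmf.prob (D L) {(S, E, h, m). i \<in>
    selected h})"
proof -
  have "expected_reward I (D L) = measure_pmf.expectation (D L)
     (\<lambda>w. \<Sum>i=1..opts I. val I i * indicat_real {(S, E, h, m). i \<in> selected h} w)"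
    unfolding expected_reward_def
  proof (intro integral_cong_AE, simp, simp, unfold AE_measure_pmf_iff, clarify)
    fix S E h m assume "(S, E, h, m) \<in> set_pmf (D L)"
    then have ok: "distinct (map snd h)" "selected h \<subseteq> {1..opts I}"
      using valid_log_run by (auto simp: valid_log_def)
    have "(\<Sum>(s, j)\<leftarrow>h. val I j) = sum_list (map (val I) (map snd h))"
      by (simp add: case_prod_unfold comp_def)
    also have "\<dots> = (\<Sum>j\<in>selected h. val I j)"
      by (subst sum_list_distinct_conv_sum_set) (use ok in \<open>auto simp: selected_def\<close>)
    also have "\<dots> = (\<Sum>i=1..opts I. val I i * indicat_real {(S, E, h, m). i \<in> selected h}
      (S, E, h, m))"
      by (rule sum.mono_neutral_cong_left) (use ok in auto)
    finally show "(\<Sum>(s, j)\<leftarrow>h. val I j) = (\<Sum>i=1..opts I. val I i * indicat_real {(S, E, h, m). i \<in>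
      selected h} (S, E, h, m))" .
  qed
  also have "\<dots> = (\<Sum>i=1..opts I. val I i * measure_pmf.prob (D L) {(S, E, h, m). i \<in> selected h})"
    by (subst Bochner_Integration.integral_sum) (auto intro!: integrable_real_indicator simp:
      measure_pmf.emeasure_eq_measure simp del: sum_mult_indicator)
  finally show ?thesis .
qed

lemma expected_reward_le_lp:
  obtains y where "lp_feasible I T y" "expected_reward I (D L) = lp_objective I T y"
proof -
  define y where "y i c = enn2real (compact_sel_prob L i c)" for i c
  let ?N = "opts I * T"
  have fin: "compact_sel_prob L i c = ennreal (y i c)" if "i \<in> {1..opts I}" "c \<in> {1..?N}" for i c
  proof -
    have "compact_sel_prob L i c \<le> (\<Sum>c=1..?N. compact_sel_prob L i c)" using that
      by (intro member_le_sum) auto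
    also have "\<dots> < \<top>" using sum_compact_sel_prob[OF that(1)] by simp
    finally show ?thesis by (simp add: y_def)
  qed
  have y0: "y i c \<ge> 0" for i c by (simp add: y_def)
  \<comment> \<open>Survival probabilities decrease in time, so replacing \<open>c\<close> by the
    actual time \<open>Suc t \<ge> c\<close> can only increase the coefficient
    \<open>1 / surv I i c\<close>; then \<open>sum_sel_prob_surv_le_1\<close> applies.\<close>
  have "(\<Sum>c=1..?N. y i c / surv I i c) \<le> 1" if i: "i \<in> {1..opts I}" for i
  proof -
    have "ennreal (\<Sum>c=1..?N. y i c / surv I i c)
      = (\<Sum>c=1..?N. ennreal (1 / surv I i c) * compact_sel_prob L i c)"
      using surv_pos[OF i] y0 i
      by (subst sum_ennreal[symmetric]) (auto simp: fin ennreal_mult[symmetric] less_imp_le intro!: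
        sum.cong)
    also have "\<dots> = (\<Sum>t<L. \<Sum>c=1..?N. \<integral>\<^sup>+(S, E, h, m). ennreal (1 / surv I i c) * of_bool (c
      \<le> Suc t \<and> 1 \<le> c \<and> c \<le> ?N \<and> compact_time S h = c) * sel_prob i t S E h m \<partial>D t)"
      unfolding compact_sel_prob_eq by (subst sum.swap) (simp add: sum_distrib_left case_prod_unfold
        mult.assoc nn_integral_cmult)
    also have "\<dots> = (\<Sum>t<L. \<integral>\<^sup>+(S, E, h, m). (\<Sum>c=1..?N. ennreal (1 / surv I i c) * of_bool (c
      \<le> Suc t \<and> 1 \<le> c \<and> c \<le> ?N \<and> compact_time S h = c) * sel_prob i t S E h m) \<partial>D t)"
      unfolding case_prod_unfold by (intro sum.cong refl nn_integral_sum[symmetric]) simp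
    also have "\<dots> \<le> (\<Sum>t<L. \<integral>\<^sup>+(S, E, h, m). ennreal (1 / surv I i (Suc t)) * sel_prob i t S E h m
      \<partial>D t)"
    proof (intro sum_mono nn_integral_mono, clarify)
      fix t S E h m
      have "(\<Sum>c=1..?N. ennreal (1 / surv I i c) * of_bool (c \<le> Suc t \<and> 1 \<le> c \<and> c
        \<le> ?N \<and> compact_time S h = c) * sel_prob i t S E h m)
        \<le> (\<Sum>c=1..?N. if c = compact_time S h then ennreal (1 / surv I i (Suc t)) * sel_prob i t S E
          h m else 0)"
        using surv_pos[OF i] surv_antimono[of _ "Suc t" i]
        by (intro sum_mono) (auto intro!: mult_right_mono ennreal_leI frac_le)
      also have "\<dots> \<le> ennreal (1 / surv I i (Suc t)) * sel_prob i t S E h m" by simp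
      finally show "(\<Sum>c=1..?N. ennreal (1 / surv I i c) * of_bool (c \<le> Suc t \<and> 1 \<le> c \<and> c
        \<le> ?N \<and> compact_time S h = c) * sel_prob i t S E h m) \<le> ennreal (1 / surv I i (Suc t))
        * sel_prob i t S E h m" .
    qed
    also have "\<dots> = (\<Sum>t<L. ennreal (1 / surv I i (Suc t)) * (\<integral>\<^sup>+(S, E, h, m). sel_prob i t S E h m
      \<partial>D t))"
      by (simp add: case_prod_unfold nn_integral_cmult)
    also have "\<dots> \<le> 1" by (rule sum_sel_prob_surv_le_1[OF i])
    finally show ?thesis by (simp add: ennreal_le_1)
  qed
  \<comment> \<open>The left-hand side is the probability that the compacted schedule is not yet
    finished at time \<open>\<theta>\<close>.\<close>
  moreover have "(\<Sum>c=1..\<theta>. \<Sum>i=1..opts I. Fbar I i (\<theta> - c) * y i c) \<le> 1" if \<theta>: "\<theta> \<in> {1..?N}" for \<theta>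
  proof -
    have "ennreal (\<Sum>c=1..\<theta>. \<Sum>i=1..opts I. Fbar I i (\<theta> - c) * y i c)
      = (\<Sum>c=1..\<theta>. \<Sum>i=1..opts I. ennreal (Fbar I i (\<theta> - c) * y i c))"
      using y0 by (simp add: sum_nonneg Fbar_def)
    also have "\<dots> = (\<Sum>i=1..opts I. \<Sum>c=1..\<theta>. ennreal (Fbar I i (\<theta> - c)) * compact_sel_prob L i c)"
      using y0 \<theta> by (subst sum.swap) (intro sum.cong refl, simp add: fin ennreal_mult Fbar_def)
    also have "\<dots> = (\<integral>\<^sup>+(S, E, h, m). of_bool (\<theta> < compact_time S h) \<partial>D L)" using \<theta>
      by (intro sum_Fbar_compact_sel_prob) auto
    also have "\<dots> \<le> (\<integral>\<^sup>+w. 1 \<partial>D L)" by (intro nn_integral_mono) auto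
    finally show ?thesis by (simp add: ennreal_le_1)
  qed
  ultimately have "lp_feasible I T y" using y0 by (simp add: lp_feasible_def)
  moreover have "expected_reward I (D L) = lp_objective I T y"
  proof -
    have "measure_pmf.prob (D L) {(S, E, h, m). i \<in> selected h} = (\<Sum>c=1..?N. y i c)"
      if i: "i \<in> {1..opts I}" for i
    proof -
      have "ennreal (\<Sum>c=1..?N. y i c) = (\<Sum>c=1..?N. compact_sel_prob L i c)"
        using y0 i by (simp add: fin flip: sum_ennreal)
      also note sum_compact_sel_prob[OF i]
      finally show ?thesis using y0 by (simp add: sum_nonneg)
    qed
    then have "expected_reward I (D L) = (\<Sum>i=1..opts I. \<Sum>c=1..?N. val I i * y i c)"
      unfolding expected_reward_eq by (intro sum.cong) (auto simp: sum_distrib_left)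
    then show ?thesis unfolding lp_objective_def by (subst sum.swap) simp
  qed
  ultimately show thesis by (rule that)
qed

end


section \<open>Lower bound on the availability probabilities\<close>

lemma nn_integral_of_bool:
  "(\<integral>\<^sup>+(S, E, h, K). of_bool (P S E h K) \<partial>measure_pmf M)
    = ennreal (measure_pmf.prob M {(S, E, h, K). P S E h K})"
proof -
  have "(\<integral>\<^sup>+(S, E, h, K). of_bool (P S E h K) \<partial>measure_pmf M)
    = (\<integral>\<^sup>+w. indicator {(S, E, h, K). P S E h K} w \<partial>measure_pmf M)"
    by (intro nn_integral_cong) (auto simp: indicator_def)
  then show ?thesis by (simp add: measure_pmf.emeasure_eq_measure)
qed

lemma nn_integral_add_sum:
  fixes f :: "'a \<Rightarrow> 'b \<Rightarrow> 'c \<Rightarrow> 'd \<Rightarrow> ennreal"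
  shows "(\<integral>\<^sup>+(S, E, h, K). \<integral>\<^sup>+b. f S E h K + (\<Sum>i\<in>A. g i S E h K b) \<partial>measure_pmf N \<partial>measure_pmf M)
    = (\<integral>\<^sup>+(S, E, h, K). f S E h K \<partial>M) + (\<Sum>i\<in>A. \<integral>\<^sup>+(S, E, h, K). \<integral>\<^sup>+b. g i S E h K b \<partial>N \<partial>M)"
  by (simp add: case_prod_unfold nn_integral_add nn_integral_sum)

text \<open>Along runs of the algorithm this equals \<open>K\<close> by
  \<open>selected_subset\<close>. With the union, identities for a single step hold for all states,
  including unreachable ones.\<close>

definition used :: "log \<Rightarrow> nat set \<Rightarrow> nat set" where
  "used h K = selected h \<union> K"

locale sse_alg =
  fixes I :: sse and T :: nat and x :: "nat \<Rightarrow> nat \<Rightarrow> real" and pick :: "nat set \<Rightarrow> nat"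
  assumes inst: "sse_instance I T"
    and feasible: "lp_feasible I T x"
    and max_pick: "max_pick I pick"
begin

section \<open>One step of the algorithm in terms of coins\<close>

definition \<rho> :: "nat \<Rightarrow> nat set rule" where
  "\<rho> t = alg_rule I x pick (free_prob (alg_run I x pick t) (Suc t))"

sublocale process I T "alg_run I x pick" \<rho> "{}"
  by unfold_locales (simp_all add: inst \<rho>_def Let_def online_policy_alg_rule[OF max_pick])

abbreviation D :: "nat \<Rightarrow> nat set state pmf" where
  "D \<equiv> alg_run I x pick"

definition coin_law :: "nat \<Rightarrow> (nat \<Rightarrow> bool) pmf" where
  "coin_law t = Pi_pmf {1..opts I} False
     (\<lambda>j. bernoulli_pmf (x j (Suc t) / (2 * surv I j (Suc t) * free_prob (D t) (Suc t) j)))"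

text \<open>Defined through \<open>bernoulli_pmf\<close>, this is a probability by construction.
  That the quotient is not truncated is settled later, by means of
  \<open>ready_prob_lower_bound\<close>.\<close>

definition coin_prob :: "nat \<Rightarrow> nat \<Rightarrow> real" where
  "coin_prob t j = pmf (bernoulli_pmf (x j (Suc t) / (2 * surv I j (Suc t) * free_prob (D t) (Suc t)
    j))) True"

definition considered :: "nat \<Rightarrow> (nat \<Rightarrow> nat) \<Rightarrow> (nat \<Rightarrow> nat) \<Rightarrow> log \<Rightarrow> nat set \<Rightarrow> (nat \<Rightarrow> bool) \<Rightarrow> nat set"
  where
  "considered t S E h K b =
     (if dm_free S h (Suc t) then {j\<in>{1..opts I}. E j > Suc t \<and> j \<notin> used h K \<and> b j} else {})"

definition next_log :: "nat \<Rightarrow> log \<Rightarrow> nat set \<Rightarrow> log" where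
  "next_log t h A = (if A = {} then h else (Suc t, pick A) # h)"

lemma considered_subset: "considered t S E h K b \<subseteq> {1..opts I} - used h K"
  by (auto simp: considered_def)

lemma pick_in: "A \<subseteq> {1..opts I} \<Longrightarrow> A \<noteq> {} \<Longrightarrow> pick A \<in> A"
  using max_pick by (simp add: max_pick_def)

lemma pick_considered: "considered t S E h K b \<noteq> {} \<Longrightarrow> pick (considered t S E h K b) \<in> considered t S
  E h K b"
  by (rule pick_in) (auto simp: considered_def)

lemma used_next_log: "used (next_log t h (considered t S E h K b)) (K \<union> considered t S E h K b)
  = used h K \<union> considered t S E h K b"
  using pick_considered[of t S E h K b] by (auto simp: used_def next_log_def)

lemma nn_integral_coin:
  assumes "j \<in> {1..opts I}" and G: "\<And>b c. G (b(j := c)) = G b"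
  shows "(\<integral>\<^sup>+b. of_bool (b j) * G b \<partial>coin_law t) = ennreal (coin_prob t j) * (\<integral>\<^sup>+b. G b \<partial>coin_law t)"
proof -
  let ?P = "bernoulli_pmf (x j (Suc t) / (2 * surv I j (Suc t) * free_prob (D t) (Suc t) j))"
  have "(\<integral>\<^sup>+y. of_bool y \<partial>?P) = (\<integral>\<^sup>+y. indicator {True} y \<partial>?P)"
    by (intro nn_integral_cong) (auto simp: indicator_def)
  also have "\<dots> = ennreal (coin_prob t j)" by (simp add: coin_prob_def emeasure_pmf_single)
  finally show ?thesis
    using nn_integral_Pi_pmf_component[where A = "{1..opts I}" and j = j and g = of_bool and F
      = G and u = False] assms
    unfolding coin_law_def by simp
qed

lemma nn_integral_Suc_coins:
  fixes \<psi> :: "(nat \<Rightarrow> nat) \<Rightarrow> (nat \<Rightarrow> nat) \<Rightarrow> log \<Rightarrow> nat set \<Rightarrow> ennreal"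
  shows "(\<integral>\<^sup>+(S, E, h, K). \<psi> S E h K \<partial>D (Suc t)) =
   (\<integral>\<^sup>+(S, E, h, K). \<integral>\<^sup>+b. \<psi> S E (next_log t h (considered t S E h K b)) (K \<union> considered t S E h K b)
     \<partial>coin_law t \<partial>D t)"
proof -
  have "(\<integral>\<^sup>+(S', E', h', K'). \<psi> S' E' h' K' \<partial>step I (Suc t) (\<rho> t) (S, E, h, K))
     = (\<integral>\<^sup>+b. \<psi> S E (next_log t h (considered t S E h K b)) (K \<union> considered t S E h K b)
       \<partial>coin_law t)" for S E h K
  proof (cases "dm_free S h (Suc t)")
    case False
    then show ?thesis by (subst nn_integral_step) (simp add: considered_def next_log_def)
  next
    case True
    define C where "C = available I (observe I (Suc t) S E h) - K"
    have C: "C = {j\<in>{1..opts I}. E j > Suc t \<and> j \<notin> used h K}"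
      by (auto simp: C_def available_def observe_def used_def split: if_splits)
    have "considered t S E h K b = {j\<in>C. b j}" for b using True by (auto simp: considered_def C)
    moreover have "{j\<in>C. j \<in> C \<and> b j} = {j\<in>C. b j}" for b by auto
    moreover have "now (observe I (Suc t) S E h) = Suc t" by (simp add: observe_def)
    moreover have "Pi_pmf C False p = map_pmf (\<lambda>f j. j \<in> C \<and> f j) (Pi_pmf {1..opts I} False p)" for
      p :: "nat \<Rightarrow> bool pmf"
    proof -
      have "(\<lambda>f j. if j \<in> C then f j else False) = (\<lambda>f j. j \<in> C \<and> f j)" by (simp add: fun_eq_iff)
      moreover have "C \<subseteq> {1..opts I}" by (auto simp: C)
      ultimately show ?thesis using Pi_pmf_subset[of "{1..opts I}" C False p] by simp
    qed
    moreover have "next_log t h A = (case (if A = {} then None else Some (pick A)) of None \<Rightarrow> h |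
      Some j \<Rightarrow> (Suc t, j) # h)" for A
      by (simp add: next_log_def)
    ultimately show ?thesis using True
      by (subst nn_integral_step) (simp add: \<rho>_def alg_rule_def Let_def coin_law_def
        C_def[symmetric] case_prod_unfold cong: option.case_cong if_cong)
  qed
  then show ?thesis by (simp only: nn_integral_Suc)
qed

text \<open>Being unconsidered is evidence for having expired. If \<open>j\<close> stays unconsidered then its coin
  shows \<open>False\<close>, the decision-maker is busy, or \<open>j\<close> has expired. Dropping the last alternative
  leaves an event which does not depend on \<open>E j\<close>, loses nothing on the left-hand side, and can only
  decrease the right-hand side.\<close>

lemma surv_given_unused:
  fixes \<psi> :: "(nat \<Rightarrow> nat) \<Rightarrow> (nat \<Rightarrow> nat) \<Rightarrow> log \<Rightarrow> nat set \<Rightarrow> ennreal"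
  assumes j: "j \<in> {1..opts I}" and "s \<ge> t"
    and \<psi>: "\<And>S E h K e. j \<notin> used h K \<Longrightarrow> \<psi> S (E(j := e)) h K = \<psi> S E h K"
  shows "(\<integral>\<^sup>+(S, E, h, K). of_bool (j \<notin> used h K \<and> E j > s) * \<psi> S E h K \<partial>D t)
     \<le> ennreal (surv I j s) * (\<integral>\<^sup>+(S, E, h, K). of_bool (j \<notin> used h K) * \<psi> S E h K \<partial>D t)"
  using assms(2,3)
proof (induction t arbitrary: \<psi>)
  case 0
  have \<psi>0: "\<psi> S (E(j := 0)) [] {} = \<psi> S E [] {}" for S E
    by (rule 0) (simp add: used_def)
  have "(\<integral>\<^sup>+e. of_bool (s < e) \<partial>exp_law I j) = (\<integral>\<^sup>+e. indicator {e. e > s} e \<partial>exp_law I j)"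
    by (intro nn_integral_cong) (auto simp: indicator_def)
  also have "\<dots> = ennreal (surv I j s)"
    by (simp add: surv_def measure_pmf.emeasure_eq_measure)
  finally have "(\<integral>\<^sup>+E. of_bool (E j > s) * \<psi> S E [] {} \<partial>Pi_pmf {1..opts I} 0 (exp_law I))
      = ennreal (surv I j s) * (\<integral>\<^sup>+E. \<psi> S E [] {} \<partial>Pi_pmf {1..opts I} 0 (exp_law I))" for S
    using nn_integral_Pi_pmf_component[where A = "{1..opts I}" and j = j
      and g = "\<lambda>e. of_bool (e > s)" and F = "\<lambda>E. \<psi> S E [] {}" and u = 0] j
    by (simp add: \<psi>0)
  then show ?case
    unfolding D0 nn_integral_initial by (simp add: used_def nn_integral_cmult)
next
  case (Suc t)
  define \<psi>' where "\<psi>' S E h K = (\<integral>\<^sup>+b. of_bool (\<not> b j \<or> \<not> dm_free S h (Suc t))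
     * \<psi> S E (next_log t h (considered t S E h K b)) (K \<union> considered t S E h K b) \<partial>coin_law t)" for
       S E h K
  have j_notin: "j \<notin> considered t S E h K b" if "\<not> b j \<or> \<not> dm_free S h (Suc t)" for S E h K b
    using that by (auto simp: considered_def)
  have j_in: "j \<in> considered t S E h K b \<longleftrightarrow> dm_free S h (Suc t) \<and> j \<notin> used h K \<and> b j"
    if "s < E j" for S E h K b
    using that j Suc.prems(1) by (auto simp: considered_def)
  have "(\<integral>\<^sup>+(S, E, h, K). of_bool (j \<notin> used h K \<and> E j > s) * \<psi> S E h K \<partial>D (Suc t))
     = (\<integral>\<^sup>+(S, E, h, K). of_bool (j \<notin> used h K \<and> E j > s) * \<psi>' S E h K \<partial>D t)"
    unfolding nn_integral_Suc_coins unfolding \<psi>'_def case_prod_unfold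
    by (subst nn_integral_cmult[symmetric], simp, intro nn_integral_cong)
      (auto simp: used_next_log j_in)
  also have "\<dots> \<le> ennreal (surv I j s) * (\<integral>\<^sup>+(S, E, h, K). of_bool (j \<notin> used h K) * \<psi>' S E h K \<partial>D t)"
  proof (rule Suc.IH)
    show "\<psi>' S (E(j := e)) h K = \<psi>' S E h K" if "j \<notin> used h K" for S E h K e
      unfolding \<psi>'_def
    proof (intro nn_integral_cong)
      fix b
      show "of_bool (\<not> b j \<or> \<not> dm_free S h (Suc t)) * \<psi> S (E(j := e))
        (next_log t h (considered t S (E(j := e)) h K b)) (K \<union> considered t S (E(j := e)) h K b)
        = of_bool (\<not> b j \<or> \<not> dm_free S h (Suc t)) * \<psi> S E (next_log t h (considered t S E h K b))
          (K \<union> considered t S E h K b)"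
      proof (cases "\<not> b j \<or> \<not> dm_free S h (Suc t)")
        case True
        then have eq: "considered t S (E(j := e)) h K b = considered t S E h K b"
          by (auto simp: considered_def)
        have "j \<notin> considered t S E h K b" using True by (rule j_notin)
        then have nu: "j \<notin> used (next_log t h (considered t S E h K b)) (K \<union> considered t S E h K
          b)"
          using that by (simp add: used_next_log)
        then show ?thesis by (simp only: eq Suc.prems(2)[OF nu])
      qed simp
    qed
  qed (use Suc.prems in simp)
  also have "(\<integral>\<^sup>+(S, E, h, K). of_bool (j \<notin> used h K) * \<psi>' S E h K \<partial>D t)
     \<le> (\<integral>\<^sup>+(S, E, h, K). of_bool (j \<notin> used h K) * \<psi> S E h K \<partial>D (Suc t))"
    unfolding nn_integral_Suc_coins unfolding \<psi>'_def case_prod_unfold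
    by (subst nn_integral_cmult[symmetric], simp, intro nn_integral_mono)
      (auto simp: used_next_log j_notin)
  finally show ?case by (simp add: mult_left_mono)
qed

declare alg_run.simps [simp del]

text \<open>In the notation of the algorithm, \<open>ready_prob t j\<close> is \<open>p\<^sub>j(t + 1) f\<^sub>j\<^sub>,\<^sub>t\<^sub>+\<^sub>1\<close>.\<close>

definition ready_prob :: "nat \<Rightarrow> nat \<Rightarrow> real" where
  "ready_prob t j = measure_pmf.prob (D t) {(S, E, h, K). j \<notin> used h K \<and> E j > Suc t
    \<and> dm_free S h (Suc t)}"

section \<open>Being ready and being considered\<close>

lemma considered_not_used: "j \<in> considered t S E h K b \<Longrightarrow> j \<notin> used h K"
  by (simp add: considered_def split: if_splits)

lemma selected_subset: "(S, E, h, K) \<in> set_pmf (D t) \<Longrightarrow> selected h \<subseteq> K"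
proof -
  have "(\<integral>\<^sup>+(S, E, h, K). of_bool (\<not> selected h \<subseteq> K) \<partial>D t) = 0"
  proof (induction t)
    case 0
    show ?case unfolding D0 nn_integral_initial by simp
  next
    case (Suc t)
    have "(\<integral>\<^sup>+(S, E, h, K). of_bool (\<not> selected h \<subseteq> K) \<partial>D (Suc t))
      \<le> (\<integral>\<^sup>+(S, E, h, K). \<integral>\<^sup>+b. of_bool (\<not> selected h \<subseteq> K) \<partial>coin_law t \<partial>D t)"
      unfolding nn_integral_Suc_coins unfolding case_prod_unfold
      by (intro nn_integral_mono) (use pick_considered in \<open>auto simp: next_log_def of_bool_def
        split: if_splits\<close>)
    then show ?case using Suc by simp
  qed
  then have "measure_pmf.prob (D t) {(S, E, h, K). \<not> selected h \<subseteq> K} = 0"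
    by (simp add: nn_integral_of_bool)
  then show "(S, E, h, K) \<in> set_pmf (D t) \<Longrightarrow> selected h \<subseteq> K"
    by (auto simp: measure_pmf_zero_iff)
qed

lemma prob_surv: "i \<in> {1..opts I} \<Longrightarrow> measure_pmf.prob (D t) {(S, E, h, K). E i > s} = surv I i s"
  using exp_marginal[of i t s] unfolding nn_integral_of_bool by (simp add: surv_def)

lemma free_prob_eq:
  assumes "j \<in> {1..opts I}"
  shows "free_prob (D t) (Suc t) j = ready_prob t j / surv I j (Suc t)"
proof -
  have "measure_pmf.prob (D t) {w. (case w of (S, E, h, K) \<Rightarrow> j \<notin> K \<and> dm_free S h (Suc t))
    \<and> (case w of (S, E, h, K) \<Rightarrow> E j > Suc t)} = ready_prob t j"
    unfolding ready_prob_def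
    by (intro measure_pmf.finite_measure_eq_AE) (auto simp: AE_measure_pmf_iff used_def dest!:
      selected_subset)
  then show ?thesis using prob_surv[OF assms, of t "Suc t"]
    by (simp add: free_prob_def cond_prob_def case_prod_unfold)
qed

text \<open>The factor \<open>f\<^sub>j\<^sub>,\<^sub>t\<close> in the coin cancels the probability
  of being ready. The last assumption rules out truncation, and if that probability is 0 it forces
  \<open>x j (Suc t) = 0\<close>.\<close>

lemma coin_prob_ready_prob:
  assumes "j \<in> {1..opts I}" "0 \<le> x j (Suc t)" "x j (Suc t) / 2 \<le> ready_prob t j"
  shows "coin_prob t j * ready_prob t j = x j (Suc t) / 2"
proof -
  have eq: "x j (Suc t) / (2 * surv I j (Suc t) * free_prob (D t) (Suc t) j)
    = x j (Suc t) / (2 * ready_prob t j)"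
    using surv_pos[OF assms(1), of "Suc t"] by (simp add: free_prob_eq[OF assms(1)])
  show ?thesis
  proof (cases "ready_prob t j = 0")
    case True
    then show ?thesis using assms by simp
  next
    case False
    then have "ready_prob t j > 0" using measure_nonneg[of "measure_pmf (D t)"]
      by (simp add: ready_prob_def less_le)
    then show ?thesis using assms unfolding coin_prob_def eq by simp
  qed
qed

lemma unused_factor:
  fixes \<psi> :: "(nat \<Rightarrow> nat) \<Rightarrow> (nat \<Rightarrow> nat) \<Rightarrow> log \<Rightarrow> nat set \<Rightarrow> ennreal"
  assumes j: "j \<in> {1..opts I}"
    and \<psi>: "\<And>S E h K a e. j \<notin> used h K \<Longrightarrow> \<psi> (S(j := a)) (E(j := e)) h K = \<psi> S E h K"
  obtains c where "\<And>P s. s \<ge> Suc t \<Longrightarrow>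
    (\<integral>\<^sup>+(S, E, h, K). of_bool (j \<notin> used h K \<and> P (S j) \<and> E j > s \<and> dm_free S h (Suc t)) * \<psi> S E h K
      \<partial>D t)
      = c * ennreal (measure_pmf.prob (eval_law I j) {a. P a} * surv I j s)"
proof -
  obtain c where c: "\<And>P s. s \<ge> Suc t \<Longrightarrow>
    (\<integral>\<^sup>+(S, E, h, K). of_bool (j \<notin> selected h \<and> P (S j) \<and> E j > s)
      * (of_bool (j \<notin> used h K \<and> dm_free S h (Suc t)) * \<psi> S E h K) \<partial>D t)
      = c * ennreal (measure_pmf.prob (eval_law I j) {a. P a} * surv I j s)"
    by (rule fresh_factor[OF j, of t "Suc t" "\<lambda>S E h K. of_bool (j \<notin> used h K \<and> dm_free S h (Suc t))
      * \<psi> S E h K"])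
       (use \<psi> in \<open>auto simp: dm_free_upd simp del: fun_upd_apply\<close>)
  show thesis
  proof (rule that[of c])
    fix P :: "nat \<Rightarrow> bool" and s assume "s \<ge> Suc t"
    show "(\<integral>\<^sup>+(S, E, h, K). of_bool (j \<notin> used h K \<and> P (S j) \<and> E j > s \<and> dm_free S h (Suc t))
      * \<psi> S E h K \<partial>D t)
      = c * ennreal (measure_pmf.prob (eval_law I j) {a. P a} * surv I j s)"
      unfolding c[OF \<open>s \<ge> Suc t\<close>, symmetric] by (intro nn_integral_cong) (auto simp: used_def)
  qed
qed

lemma nn_integral_considered:
  assumes j: "j \<in> {1..opts I}"
    and G: "\<And>S E h K b c. G S E h K (b(j := c)) = G S E h K b"
  shows "(\<integral>\<^sup>+(S, E, h, K). \<integral>\<^sup>+b. of_bool (j \<in> considered t S E h K b) * G S E h K b \<partial>coin_law t \<partial>D t)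
    = ennreal (coin_prob t j) * (\<integral>\<^sup>+(S, E, h, K). of_bool (j \<notin> used h K \<and> E j > Suc t
      \<and> dm_free S h (Suc t)) * (\<integral>\<^sup>+b. G S E h K b \<partial>coin_law t) \<partial>D t)"
proof -
  have "(\<integral>\<^sup>+b. of_bool (j \<in> considered t S E h K b) * G S E h K b \<partial>coin_law t)
     = ennreal (coin_prob t j) * (of_bool (j \<notin> used h K \<and> E j > Suc t \<and> dm_free S h (Suc t))
       * (\<integral>\<^sup>+b. G S E h K b \<partial>coin_law t))" for S E h K
  proof (cases "j \<notin> used h K \<and> E j > Suc t \<and> dm_free S h (Suc t)")
    case True
    then have "j \<in> considered t S E h K b \<longleftrightarrow> b j" for b using j by (auto simp: considered_def)
    then show ?thesis using True nn_integral_coin[OF j, of "G S E h K"] G by simp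
  next
    case False
    then have "j \<notin> considered t S E h K b" for b by (auto simp: considered_def)
    then show ?thesis using False by simp
  qed
  then show ?thesis by (simp add: case_prod_unfold nn_integral_cmult)
qed

lemma ready_prob_eq: "(\<integral>\<^sup>+(S, E, h, K). of_bool (j \<notin> used h K \<and> E j > Suc t \<and> dm_free S h (Suc t))
  \<partial>D t) = ennreal (ready_prob t j)"
  unfolding ready_prob_def nn_integral_of_bool ..

lemma ready_prob_nonneg: "ready_prob t j \<ge> 0" by (simp add: ready_prob_def)
lemma coin_prob_nonneg: "coin_prob t j \<ge> 0" by (simp add: coin_prob_def)

text \<open>An option becomes used exactly by being considered, and if it is ready at time
  \<open>Suc t\<close> then it survives until \<open>s\<close> with probability
  \<open>surv I j s / surv I j (Suc t)\<close>.\<close>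

lemma unused_surv_Suc:
  assumes j: "j \<in> {1..opts I}" and s: "s \<ge> Suc t"
  shows "measure_pmf.prob (D (Suc t)) {(S, E, h, K). j \<notin> used h K \<and> E j > s} + surv I j s
    * (coin_prob t j * ready_prob t j / surv I j (Suc t))
    = measure_pmf.prob (D t) {(S, E, h, K). j \<notin> used h K \<and> E j > s}"
proof -
  let ?c = "surv I j (Suc t)"
  obtain c where c: "\<And>P s. s \<ge> Suc t \<Longrightarrow>
    (\<integral>\<^sup>+(S, E, h, K). of_bool (j \<notin> used h K \<and> P (S j) \<and> E j > s \<and> dm_free S h (Suc t)) * 1 \<partial>D t)
      = c * ennreal (measure_pmf.prob (eval_law I j) {a. P a} * surv I j s)"
    by (rule unused_factor[OF j, of "\<lambda>_ _ _ _. 1" t]) auto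
  have F: "ennreal (ready_prob t j) = c * ennreal ?c"
    using c[of "Suc t" "\<lambda>_. True"] ready_prob_eq[of t j] by simp
  have "(\<integral>\<^sup>+(S, E, h, K). of_bool (j \<notin> used h K \<and> E j > s \<and> dm_free S h (Suc t)) \<partial>D t)
    = c * ennreal (surv I j s)"
    using c[of s "\<lambda>_. True"] s by simp
  also have "\<dots> = ennreal (ready_prob t j * surv I j s / ?c)"
  proof -
    have "ennreal ?c * (c * ennreal (surv I j s)) = ennreal (ready_prob t j) * ennreal (surv I j s)"
      by (simp add: F mult_ac)
    also have "\<dots> = ennreal ?c * ennreal (ready_prob t j * surv I j s / ?c)"
      using surv_pos[OF j, of "Suc t"] surv_pos[OF j, of s] ready_prob_nonneg[of t j]
        by (simp flip: ennreal_mult)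
    finally show ?thesis using surv_pos[OF j, of "Suc t"] by (simp add: ennreal_mult_cancel_left)
  qed
  finally have 1: "(\<integral>\<^sup>+(S, E, h, K). of_bool (j \<notin> used h K \<and> E j > s \<and> dm_free S h (Suc t)) \<partial>D t)
    = ennreal (ready_prob t j * surv I j s / ?c)" .
  have 2: "(\<integral>\<^sup>+(S, E, h, K). \<integral>\<^sup>+b. of_bool (j \<in> considered t S E h K b) * of_bool (E j > s)
    \<partial>coin_law t \<partial>D t)
      = ennreal (coin_prob t j) * ennreal (ready_prob t j * surv I j s / ?c)"
    unfolding 1[symmetric]
    by (subst nn_integral_considered[OF j])
      (use s in \<open>auto intro!: arg_cong2[where f = "(*)"] nn_integral_cong\<close>)
  have "(\<integral>\<^sup>+(S, E, h, K). of_bool (j \<notin> used h K \<and> E j > s) \<partial>D (Suc t))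
     + (\<integral>\<^sup>+(S, E, h, K). \<integral>\<^sup>+b. of_bool (j \<in> considered t S E h K b) * of_bool (E j > s) \<partial>coin_law t
       \<partial>D t)
     = (\<integral>\<^sup>+(S, E, h, K). \<integral>\<^sup>+b. of_bool (j \<notin> used h K \<and> E j > s) \<partial>coin_law t \<partial>D t)"
    unfolding nn_integral_Suc_coins unfolding case_prod_unfold
    by (subst nn_integral_add[symmetric], simp, simp, intro nn_integral_cong, subst
      nn_integral_add[symmetric], simp, simp, intro nn_integral_cong)
       (auto simp: used_next_log dest: considered_not_used)
  also have "\<dots> = (\<integral>\<^sup>+(S, E, h, K). of_bool (j \<notin> used h K \<and> E j > s) \<partial>D t)"
    by (simp add: case_prod_unfold)
  finally have "ennreal (measure_pmf.prob (D (Suc t)) {(S, E, h, K). j \<notin> used h K \<and> E j > s}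
    + coin_prob t j * (ready_prob t j * surv I j s / ?c))
    = ennreal (measure_pmf.prob (D t) {(S, E, h, K). j \<notin> used h K \<and> E j > s})"
    unfolding 2 nn_integral_of_bool using coin_prob_nonneg ready_prob_nonneg surv_pos[OF j]
    by (simp add: less_imp_le flip: ennreal_mult ennreal_plus)
  then show ?thesis
    using coin_prob_nonneg ready_prob_nonneg surv_pos[OF j]
      by (subst (asm) ennreal_inj) (auto simp: less_imp_le mult_ac)
qed

text \<open>Conditioning on the survival of \<open>j\<close> could favour the selection of other options, so the
  probability that \<open>i\<close> is considered is compared by \<open>surv_given_unused\<close> with the unconditional
  one.\<close>

lemma busy_Suc:
  assumes j: "j \<in> {1..opts I}" and \<theta>: "\<theta> \<ge> Suc t"
  shows "measure_pmf.prob (D (Suc t)) {(S, E, h, K). j \<notin> used h K \<and> E j > \<theta> \<and> \<not> dm_free S h \<theta>}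
    \<le> measure_pmf.prob (D t) {(S, E, h, K). j \<notin> used h K \<and> E j > \<theta> \<and> \<not> dm_free S h \<theta>}
      + surv I j \<theta> * (\<Sum>i=1..opts I. Fbar I i (\<theta> - Suc t) * (coin_prob t i * ready_prob t i))"
proof -
  have term_le: "(\<integral>\<^sup>+(S, E, h, K). \<integral>\<^sup>+b. of_bool (i \<in> considered t S E h K b)
    * of_bool (i \<noteq> j \<and> j \<notin> used h K \<and> E j > \<theta> \<and> S i > \<theta> - Suc t) \<partial>coin_law t \<partial>D t)
     \<le> ennreal (surv I j \<theta> * (Fbar I i (\<theta> - Suc t) * (coin_prob t i * ready_prob t i)))"
       if i: "i \<in> {1..opts I}" for i
  proof (cases "i = j")
    case True
    then show ?thesis by (simp add: case_prod_unfold)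
  next
    case False
    let ?p = "ennreal (surv I i (Suc t))" and ?F = "ennreal (Fbar I i (\<theta> - Suc t))"
    \<comment> \<open>Given that \<open>i\<close> is ready, \<open>S i\<close> is independent of the
      rest of the integrand, which yields the factor \<open>Fbar\<close>. The survival of
      \<open>j\<close> is then handled by \<open>surv_given_unused\<close>.\<close>
    obtain c where c: "\<And>P s. s \<ge> Suc t \<Longrightarrow>
      (\<integral>\<^sup>+(S, E, h, K). of_bool (i \<notin> used h K \<and> P (S i) \<and> E i > s \<and> dm_free S h (Suc t))
        * of_bool (j \<notin> used h K \<and> E j > \<theta>) \<partial>D t)
        = c * ennreal (measure_pmf.prob (eval_law I i) {a. P a} * surv I i s)"
      by (rule unused_factor[OF i, of "\<lambda>S E h K. of_bool (j \<notin> used h K \<and> E j > \<theta>)" t])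
        (use False in auto)
    have "(\<integral>\<^sup>+(S, E, h, K). of_bool (i \<notin> used h K \<and> S i > \<theta> - Suc t \<and> E i > Suc t
      \<and> dm_free S h (Suc t)) * of_bool (j \<notin> used h K \<and> E j > \<theta>) \<partial>D t)
       = ?F * (c * ?p)"
      using c[of "Suc t" "\<lambda>a. a > \<theta> - Suc t"] by (simp add: Fbar_def surv_def ennreal_mult mult_ac)
    note eq = this
    have "c * ?p = (\<integral>\<^sup>+(S, E, h, K). of_bool (j \<notin> used h K \<and> E j > \<theta>) * of_bool (i \<notin> used h K
      \<and> E i > Suc t \<and> dm_free S h (Suc t)) \<partial>D t)"
      using c[of "Suc t" "\<lambda>_. True"] by (simp add: mult.commute)
    also have "\<dots> \<le> ennreal (surv I j \<theta>) * (\<integral>\<^sup>+(S, E, h, K). of_bool (j \<notin> used h K)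
      * of_bool (i \<notin> used h K \<and> E i > Suc t \<and> dm_free S h (Suc t)) \<partial>D t)"
      by (rule surv_given_unused[OF j]) (use \<theta> False in auto)
    also have "\<dots> \<le> ennreal (surv I j \<theta>) * ennreal (ready_prob t i)"
      unfolding ready_prob_eq[symmetric] by (intro mult_left_mono nn_integral_mono) auto
    finally have cp: "c * ?p \<le> ennreal (surv I j \<theta>) * ennreal (ready_prob t i)" .
    have *: "(\<integral>\<^sup>+(S, E, h, K). of_bool (i \<notin> used h K \<and> S i > \<theta> - Suc t \<and> E i > Suc t
      \<and> dm_free S h (Suc t)) * of_bool (j \<notin> used h K \<and> E j > \<theta>) \<partial>D t)
        \<le> ?F * (ennreal (surv I j \<theta>) * ennreal (ready_prob t i))" unfolding eq
          by (intro mult_left_mono cp) simp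
    have "(\<integral>\<^sup>+(S, E, h, K). \<integral>\<^sup>+b. of_bool (i \<in> considered t S E h K b) * of_bool (i \<noteq> j \<and> j \<notin> used h K
      \<and> E j > \<theta> \<and> S i > \<theta> - Suc t) \<partial>coin_law t \<partial>D t)
      = ennreal (coin_prob t i) * (\<integral>\<^sup>+(S, E, h, K). of_bool (i \<notin> used h K \<and> S i > \<theta> - Suc t
        \<and> E i > Suc t \<and> dm_free S h (Suc t)) * of_bool (j \<notin> used h K \<and> E j > \<theta>) \<partial>D t)"
      by (subst nn_integral_considered[OF i], simp, rule arg_cong2[where f = "(*)", OF refl], rule
        nn_integral_cong)
         (use False in \<open>auto simp: of_bool_def\<close>)
    also have "\<dots> \<le> ennreal (coin_prob t i)
      * (?F * (ennreal (surv I j \<theta>) * ennreal (ready_prob t i)))"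
      by (intro mult_left_mono *) simp
    also have "\<dots> = ennreal (surv I j \<theta> * (Fbar I i (\<theta> - Suc t) * (coin_prob t i * ready_prob t i)))"
      using coin_prob_nonneg[of t i] ready_prob_nonneg[of t i] surv_pos[OF j, of \<theta>]
      by (simp add: Fbar_def less_imp_le mult_ac flip: ennreal_mult)
    finally show ?thesis .
  qed
  have "(\<integral>\<^sup>+(S, E, h, K). of_bool (j \<notin> used h K \<and> E j > \<theta> \<and> \<not> dm_free S h \<theta>) \<partial>D (Suc t))
     \<le> (\<integral>\<^sup>+(S, E, h, K). \<integral>\<^sup>+b. of_bool (j \<notin> used h K \<and> E j > \<theta> \<and> \<not> dm_free S h \<theta>)
        + (\<Sum>i=1..opts I. of_bool (i \<in> considered t S E h K b) * of_bool (i \<noteq> j \<and> j \<notin> used h K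
          \<and> E j > \<theta> \<and> S i > \<theta> - Suc t)) \<partial>coin_law t \<partial>D t)"
    unfolding nn_integral_Suc_coins
  proof (intro nn_integral_mono, clarify, intro nn_integral_mono)
    fix S E h K b
    let ?A = "considered t S E h K b"
    let ?t = "\<lambda>i. of_bool (i \<in> ?A) * of_bool (i \<noteq> j \<and> j \<notin> used h K \<and> E j > \<theta> \<and> S i > \<theta> - Suc t) ::
      ennreal"
    show "of_bool (j \<notin> used (next_log t h ?A) (K \<union> ?A) \<and> E j > \<theta> \<and> \<not> dm_free S (next_log t h ?A) \<theta>)
      \<le> of_bool (j \<notin> used h K \<and> E j > \<theta> \<and> \<not> dm_free S h \<theta>) + (\<Sum>i=1..opts I. ?t i)"
    proof (cases "(j \<notin> used (next_log t h ?A) (K \<union> ?A) \<and> E j > \<theta> \<and> \<not> dm_free S (next_log t h ?A) \<theta>)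
      \<and> dm_free S h \<theta>")
      case True
      let ?i = "pick ?A"
      have A: "?A \<noteq> {}" using True by (auto simp: next_log_def)
      then have i: "?i \<in> ?A" by (rule pick_considered)
      have "Suc t + S ?i > \<theta>" using True A by (auto simp: next_log_def dm_free_def)
      then have "?t ?i = 1" using True i \<theta> by (auto simp: used_next_log of_bool_def)
      moreover have "?t ?i \<le> (\<Sum>i=1..opts I. ?t i)" using i considered_subset[of t S E h K b]
        by (intro member_le_sum) auto
      ultimately show ?thesis by (auto intro: order_trans[OF _ add_increasing])
    next
      case False
      then show ?thesis by (auto simp: used_next_log of_bool_def)
    qed
  qed
  also have "\<dots> = (\<integral>\<^sup>+(S, E, h, K). of_bool (j \<notin> used h K \<and> E j > \<theta> \<and> \<not> dm_free S h \<theta>) \<partial>D t)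
     + (\<Sum>i=1..opts I. \<integral>\<^sup>+(S, E, h, K). \<integral>\<^sup>+b. of_bool (i \<in> considered t S E h K b)
       * of_bool (i \<noteq> j \<and> j \<notin> used h K \<and> E j > \<theta> \<and> S i > \<theta> - Suc t) \<partial>coin_law t \<partial>D t)"
    by (rule nn_integral_add_sum)
  also have "\<dots> \<le> (\<integral>\<^sup>+(S, E, h, K). of_bool (j \<notin> used h K \<and> E j > \<theta> \<and> \<not> dm_free S h \<theta>) \<partial>D t)
     + (\<Sum>i=1..opts I. ennreal (surv I j \<theta> * (Fbar I i (\<theta> - Suc t)
       * (coin_prob t i * ready_prob t i))))"
    by (intro add_left_mono sum_mono term_le)
  finally have le: "(\<integral>\<^sup>+(S, E, h, K). of_bool (j \<notin> used h K \<and> E j > \<theta> \<and> \<not> dm_free S h \<theta>) \<partial>D (Suc t))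
    \<le> \<dots>" .
  have sum_eq: "(\<Sum>i=1..opts I. ennreal (surv I j \<theta> * (Fbar I i (\<theta> - Suc t)
    * (coin_prob t i * ready_prob t i))))
     = ennreal (surv I j \<theta> * (\<Sum>i=1..opts I. Fbar I i (\<theta> - Suc t)
       * (coin_prob t i * ready_prob t i)))"
    using surv_pos[OF j, of \<theta>] by (subst sum_ennreal) (auto simp: sum_distrib_left coin_prob_nonneg
      ready_prob_nonneg Fbar_def)
  let ?r = "surv I j \<theta> * (\<Sum>i=1..opts I. Fbar I i (\<theta> - Suc t) * (coin_prob t i * ready_prob t i))"
  have "?r \<ge> 0"
    by (intro mult_nonneg_nonneg sum_nonneg coin_prob_nonneg ready_prob_nonneg)
      (simp_all add: Fbar_def surv_def)
  then show ?thesis using le unfolding nn_integral_of_bool sum_eq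
    by (subst (asm) ennreal_plus[symmetric], simp, simp, subst (asm) ennreal_le_iff) simp_all
qed

section \<open>The induction over time\<close>

lemma x_nonneg: "j \<in> {1..opts I} \<Longrightarrow> 1 \<le> t \<Longrightarrow> t \<le> opts I * T \<Longrightarrow> x j t \<ge> 0"
  using feasible by (simp add: lp_feasible_def)

lemma initial_empty: "(S, E, h, K) \<in> set_pmf (D 0) \<Longrightarrow> h = [] \<and> K = {}"
  by (auto simp: D0 initial_def)

text \<open>Unrolls \<open>unused_surv_Suc\<close>. Hypothesis \<open>H\<close> concerns only times
  before \<open>t\<close>, so it is available within the induction of
  \<open>ready_prob_lower_bound\<close>; \<open>prob_busy\<close> has the same form.\<close>

lemma prob_unused:
  assumes j: "j \<in> {1..opts I}" and s: "s \<ge> t"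
    and H: "\<And>\<tau>. \<tau> < t \<Longrightarrow> coin_prob \<tau> j * ready_prob \<tau> j = x j (Suc \<tau>) / 2"
  shows "measure_pmf.prob (D t) {(S, E, h, K). j \<notin> used h K \<and> E j > s}
    = surv I j s * (1 - (\<Sum>\<tau><t. x j (Suc \<tau>) / surv I j (Suc \<tau>)) / 2)"
  using s H
proof (induction t)
  case 0
  have "measure_pmf.prob (D 0) {(S, E, h, K). j \<notin> used h K \<and> E j > s}
    = measure_pmf.prob (D 0) {(S, E, h, K). E j > s}"
    by (intro measure_pmf.finite_measure_eq_AE) (auto simp: AE_measure_pmf_iff used_def dest!:
      initial_empty)
  then show ?case using prob_surv[OF j, of 0 s] by simp
next
  case (Suc t)
  have IH: "measure_pmf.prob (D t) {(S, E, h, K). j \<notin> used h K \<and> E j > s}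
    = surv I j s * (1 - (\<Sum>\<tau><t. x j (Suc \<tau>) / surv I j (Suc \<tau>)) / 2)"
    using Suc by simp
  have qF: "coin_prob t j * ready_prob t j = x j (Suc t) / 2" using Suc.prems(2) by simp
  have "measure_pmf.prob (D (Suc t)) {(S, E, h, K). j \<notin> used h K \<and> E j > s}
      = surv I j s * (1 - (\<Sum>\<tau><t. x j (Suc \<tau>) / surv I j (Suc \<tau>)) / 2) - surv I j s
        * (x j (Suc t) / 2 / surv I j (Suc t))"
    using unused_surv_Suc[OF j Suc.prems(1)] unfolding IH qF by linarith
  then show ?case by (simp add: algebra_simps add_divide_distrib)
qed

lemma prob_busy:
  assumes j: "j \<in> {1..opts I}" and \<theta>: "\<theta> \<ge> t"
    and H: "\<And>\<tau> i. \<tau> < t \<Longrightarrow> i \<in> {1..opts I} \<Longrightarrow> coin_prob \<tau> i * ready_prob \<tau> i = x i (Suc \<tau>) / 2"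
  shows "measure_pmf.prob (D t) {(S, E, h, K). j \<notin> used h K \<and> E j > \<theta> \<and> \<not> dm_free S h \<theta>}
    \<le> surv I j \<theta> * ((\<Sum>\<tau><t. \<Sum>i=1..opts I. Fbar I i (\<theta> - Suc \<tau>) * x i (Suc \<tau>)) / 2)"
  using \<theta> H
proof (induction t)
  case 0
  have "measure_pmf.prob (D 0) {(S, E, h, K). j \<notin> used h K \<and> E j > \<theta> \<and> \<not> dm_free S h \<theta>} = 0"
    by (auto simp: measure_pmf_zero_iff dm_free_def simp del: alg_run.simps dest!: initial_empty)
  then show ?case by simp
next
  case (Suc t)
  have "measure_pmf.prob (D t) {(S, E, h, K). j \<notin> used h K \<and> E j > \<theta> \<and> \<not> dm_free S h \<theta>}
    \<le> surv I j \<theta> * ((\<Sum>\<tau><t. \<Sum>i=1..opts I. Fbar I i (\<theta> - Suc \<tau>) * x i (Suc \<tau>)) / 2)"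
    using Suc by simp
  moreover have qF: "(\<Sum>i=1..opts I. Fbar I i (\<theta> - Suc t) * (coin_prob t i * ready_prob t i))
    = (\<Sum>i=1..opts I. Fbar I i (\<theta> - Suc t) * x i (Suc t)) / 2"
    unfolding sum_divide_distrib by (intro sum.cong refl) (simp add: Suc.prems(2))
  moreover have "surv I j \<theta> * ((\<Sum>\<tau><Suc t. \<Sum>i=1..opts I. Fbar I i (\<theta> - Suc \<tau>) * x i (Suc \<tau>)) / 2)
      = surv I j \<theta> * ((\<Sum>\<tau><t. \<Sum>i=1..opts I. Fbar I i (\<theta> - Suc \<tau>) * x i (Suc \<tau>)) / 2)
        + surv I j \<theta> * ((\<Sum>i=1..opts I. Fbar I i (\<theta> - Suc t) * x i (Suc t)) / 2)"
    by (simp add: add_divide_distrib distrib_left)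
  ultimately show ?case using busy_Suc[OF j Suc.prems(1)] unfolding qF by linarith
qed

text \<open>The factor 1/2 in the coins is spent here. Having been considered costs half of the sum
  in the first constraint of the linear program, and being busy costs half of that in the second.
  Half of each slack remains, and the terms for time \<open>Suc t\<close> itself bound the slacks
  from below by \<open>x\<^sub>j / p\<^sub>j\<close> and \<open>m\<close>.\<close>

lemma ready_prob_lower_bound:
  assumes "j \<in> {1..opts I}" "Suc t \<le> opts I * T"
  shows "ready_prob t j \<ge> x j (Suc t) / 2 + surv I j (Suc t) * ((\<Sum>i=1..opts I. x i (Suc t)) / 2)"
  using assms
proof (induction t arbitrary: j rule: less_induct)
  case (less t)
  let ?p = "surv I j (Suc t)" and ?m = "\<Sum>i=1..opts I. x i (Suc t)"
  \<comment> \<open>By the induction hypothesis no earlier coin was truncated.\<close>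
  have H: "coin_prob \<tau> i * ready_prob \<tau> i = x i (Suc \<tau>) / 2" if "\<tau> < t" "i \<in> {1..opts I}" for \<tau> i
  proof (rule coin_prob_ready_prob[OF that(2)])
    have \<tau>: "Suc \<tau> \<le> opts I * T" using that less.prems by simp
    show "0 \<le> x i (Suc \<tau>)" using x_nonneg that(2) \<tau> by simp
    have "0 \<le> (\<Sum>i=1..opts I. x i (Suc \<tau>))" using x_nonneg \<tau> by (intro sum_nonneg) auto
    then have "0 \<le> surv I i (Suc \<tau>) * ((\<Sum>i=1..opts I. x i (Suc \<tau>)) / 2)" by (simp add: surv_def)
    then show "x i (Suc \<tau>) / 2 \<le> ready_prob \<tau> i" using less.IH[OF that \<tau>] by linarith
  qed
  have eq: "measure_pmf.prob (D t) {(S, E, h, K). j \<notin> used h K \<and> E j > Suc t}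
      = ready_prob t j + measure_pmf.prob (D t) {(S, E, h, K). j \<notin> used h K \<and> E j > Suc t
        \<and> \<not> dm_free S h (Suc t)}"
    unfolding ready_prob_def by (subst measure_pmf.finite_measure_Union[symmetric])
      (auto intro!: arg_cong2[where f = measure])
  have "(\<Sum>\<tau>=1..opts I * T. x j \<tau> / surv I j \<tau>) \<le> 1"
    using feasible less.prems(1) by (simp add: lp_feasible_def)
  moreover have "(\<Sum>\<tau>=1..Suc t. x j \<tau> / surv I j \<tau>) \<le> (\<Sum>\<tau>=1..opts I * T. x j \<tau> / surv I j \<tau>)"
    by (rule sum_mono2) (use less.prems x_nonneg in \<open>auto simp: surv_def\<close>)
  moreover have "(\<Sum>\<tau>=1..Suc t. x j \<tau> / surv I j \<tau>) = (\<Sum>\<tau><t. x j (Suc \<tau>) / surv I j (Suc \<tau>))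
    + x j (Suc t) / ?p"
    by (simp add: sum.atLeast1_atMost_eq flip: lessThan_Suc_atMost)
  ultimately have 1: "(\<Sum>\<tau><t. x j (Suc \<tau>) / surv I j (Suc \<tau>)) + x j (Suc t) / ?p \<le> 1" by linarith
  have "(\<Sum>\<tau>=1..Suc t. \<Sum>i=1..opts I. Fbar I i (Suc t - \<tau>) * x i \<tau>) \<le> 1"
    using feasible less.prems(2) by (simp add: lp_feasible_def del: sum.cl_ivl_Suc)
  \<comment> \<open>The term for \<open>\<tau> = Suc t\<close> is \<open>m\<close>, because
    evaluation times are positive and so \<open>Fbar I i 0 = 1\<close>.\<close>
  moreover have "(\<Sum>\<tau>=1..Suc t. \<Sum>i=1..opts I. Fbar I i (Suc t - \<tau>) * x i \<tau>)
     = (\<Sum>\<tau><t. \<Sum>i=1..opts I. Fbar I i (Suc t - Suc \<tau>) * x i (Suc \<tau>)) + ?m"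
    by (simp add: sum.atLeast1_atMost_eq Fbar_0 flip: lessThan_Suc_atMost)
  ultimately have 2: "(\<Sum>\<tau><t. \<Sum>i=1..opts I. Fbar I i (Suc t - Suc \<tau>) * x i (Suc \<tau>)) + ?m \<le> 1"
    by linarith
  let ?A = "\<Sum>\<tau><t. x j (Suc \<tau>) / surv I j (Suc \<tau>)"
  let ?B = "\<Sum>\<tau><t. \<Sum>i=1..opts I. Fbar I i (Suc t - Suc \<tau>) * x i (Suc \<tau>)"
  have p: "?p > 0" by (rule surv_pos[OF less.prems(1)])
  have "ready_prob t j \<ge> ?p * (1 - ?A / 2) - ?p * (?B / 2)"
    using eq prob_unused[OF less.prems(1), of t "Suc t"] prob_busy[OF less.prems(1), of t "Suc t"] H
      less.prems(1) by simp
  also have "?p * (1 - ?A / 2) - ?p * (?B / 2) = ?p * ((1 - ?A) / 2 + (1 - ?B) / 2)"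
    by (simp add: field_simps)
  finally have "ready_prob t j \<ge> ?p * ((1 - ?A) / 2 + (1 - ?B) / 2)" .
  moreover have "?p * ((1 - ?A) / 2 + (1 - ?B) / 2) \<ge> ?p * (x j (Suc t) / ?p / 2 + ?m / 2)"
    using 1 2 p by (intro mult_left_mono add_mono divide_right_mono) linarith+
  moreover have "?p * (x j (Suc t) / ?p / 2 + ?m / 2) = x j (Suc t) / 2 + ?p * (?m / 2)"
    using p by (simp add: distrib_left)
  ultimately show ?case by linarith
qed

text \<open>The second claim comes from the summand with \<open>m\<close> in
  \<open>ready_prob_lower_bound\<close>. For \<open>m > 0\<close> it bounds the product of coin and
  survival probability by \<open>x\<^sub>j / m\<close>, the weight given to
  \<open>greedy\<close>.\<close>

lemma considered_prob:
  assumes "j \<in> {1..opts I}" "Suc t \<le> opts I * T"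
  shows "coin_prob t j * ready_prob t j = x j (Suc t) / 2"
    and "coin_prob t j * surv I j (Suc t) * (\<Sum>i=1..opts I. x i (Suc t)) \<le> x j (Suc t)"
proof -
  let ?m = "\<Sum>i=1..opts I. x i (Suc t)"
  have x0: "0 \<le> x j (Suc t)" using x_nonneg assms by simp
  have "0 \<le> ?m" using x_nonneg assms by (intro sum_nonneg) auto
  then have "0 \<le> surv I j (Suc t) * (?m / 2)" by (simp add: surv_def)
  then show qF: "coin_prob t j * ready_prob t j = x j (Suc t) / 2"
    using ready_prob_lower_bound[OF assms] x0 by (intro coin_prob_ready_prob assms) linarith+
  have "coin_prob t j * (surv I j (Suc t) * (?m / 2)) \<le> coin_prob t j * ready_prob t j"
    using ready_prob_lower_bound[OF assms] x0 by (intro mult_left_mono coin_prob_nonneg) linarith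
  then show "coin_prob t j * surv I j (Suc t) * ?m \<le> x j (Suc t)" unfolding qF by simp
qed

end


section \<open>The value of the best considered option\<close>

text \<open>For a list sorted by decreasing value this is the largest value of an option of the list
  in \<open>A\<close>. The list recursion is the one along which the algorithm is compared with
  \<open>greedy\<close>.\<close>

fun best :: "(nat \<Rightarrow> real) \<Rightarrow> nat list \<Rightarrow> nat set \<Rightarrow> real" where
  "best v [] A = 0"
| "best v (j # js) A = (if j \<in> A then v j else best v js A)"

text \<open>The expectation of \<open>best v js A\<close> for a random set \<open>A\<close> that contains each \<open>j\<close> independently
  with probability \<open>w j\<close>.\<close>

fun greedy :: "(nat \<Rightarrow> real) \<Rightarrow> (nat \<Rightarrow> real) \<Rightarrow> nat list \<Rightarrow> real" where
  "greedy v w [] = 0"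
| "greedy v w (j # js) = w j * v j + (1 - w j) * greedy v w js"

lemma greedy_snoc: "greedy v w (js @ [k]) = greedy v w js + (\<Prod>j\<leftarrow>js. 1 - w j) * w k * v k"
  by (induction js) (simp_all add: algebra_simps)

text \<open>The constant \<open>c\<close> is collected unless the random set misses the whole list,
  which has probability \<open>\<Prod>j. 1 - w j\<close>.\<close>

lemma greedy_shift: "greedy v w js = greedy (\<lambda>j. v j - c) w js + c * (1 - (\<Prod>j\<leftarrow>js. 1 - w j))"
proof (induction js)
  case (Cons j js)
  show ?case by (simp only: greedy.simps Cons list.map prod_list.Cons) (simp add: algebra_simps)
qed simp

lemma prod_list_le_exp:
  assumes "\<And>j. j \<in> set js \<Longrightarrow> w j \<le> 1"
  shows "0 \<le> (\<Prod>j\<leftarrow>js. 1 - w j)" "(\<Prod>j\<leftarrow>js. 1 - w j) \<le> exp (- (\<Sum>j\<leftarrow>js. w j :: real))"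
  using assms
proof (induction js)
  case (Cons j js)
  {
    case 1
    then show ?case using Cons by simp
  next
    case 2
    have "1 - w j \<le> exp (- w j)" using exp_ge_add_one_self[of "- w j"] by simp
    then have "(1 - w j) * (\<Prod>j\<leftarrow>js. 1 - w j) \<le> exp (- w j) * exp (- (\<Sum>j\<leftarrow>js. w j))"
      using 2 Cons by (intro mult_mono) auto
    then show ?case by (simp add: mult_exp_exp)
  }
qed simp_all

text \<open>By convexity \<open>exp (- W)\<close> lies below its chord between \<open>W = 0\<close>
  and \<open>W = 1\<close>.\<close>

lemma exp_chord:
  assumes "0 \<le> W" "W \<le> (1::real)"
  shows "(1 - 1 / exp 1) * W \<le> 1 - exp (- W)"
proof -
  have "exp ((1 - W) *\<^sub>R 0 + W *\<^sub>R (- 1)) \<le> (1 - W) * exp 0 + W * exp (- 1 :: real)"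
    using convex_onD[OF exp_convex, of W 0 "- 1"] assms by simp
  then show ?thesis by (simp add: exp_minus field_simps)
qed

lemma sum_list_shift:
  fixes v w :: "nat \<Rightarrow> real"
  shows "(\<Sum>j\<leftarrow>js. w j * v j) = (\<Sum>j\<leftarrow>js. w j * (v j - c)) + c * (\<Sum>j\<leftarrow>js. w j)"
  by (induction js) (simp_all add: algebra_simps)

text \<open>Subtracting the smallest value from all values removes the last option, and for constant
  values the claim is the inequality \<open>1 - (\<Prod>j. 1 - w j) \<ge> 1 - exp (- (\<Sum>j. w j))\<close> together with
  concavity.\<close>

lemma greedy_bound:
  fixes v w :: "nat \<Rightarrow> real"
  assumes "sorted_wrt (\<lambda>i j. v i \<ge> v j) js" "\<And>j. j \<in> set js \<Longrightarrow> 0 \<le> v j \<and> 0 \<le> w j" "(\<Sum>j\<leftarrow>js. w j) \<le> 1"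
  shows "(1 - 1 / exp 1) * (\<Sum>j\<leftarrow>js. w j * v j) \<le> greedy v w js"
  using assms
proof (induction js arbitrary: v rule: rev_induct)
  case (snoc k js)
  let ?c = "v k" and ?js = "js @ [k]" and ?a = "1 - 1 / exp (1::real)"
  have ws: "(\<Sum>j\<leftarrow>?js. w j) \<le> 1" "0 \<le> w k" "0 \<le> (\<Sum>j\<leftarrow>js. w j)"
    using snoc.prems by (auto intro!: sum_list_nonneg)
  have w1: "w j \<le> 1" if "j \<in> set ?js" for j
  proof -
    have "w j \<le> (\<Sum>j\<leftarrow>?js. w j)"
      using that snoc.prems(2) by (intro member_le_sum_list) auto
    then show ?thesis using ws by linarith
  qed
  have w_js: "(\<Sum>j\<leftarrow>js. w j) \<le> 1" using ws by simp
  have "?a * (\<Sum>j\<leftarrow>js. w j * (v j - ?c)) \<le> greedy (\<lambda>j. v j - ?c) w js"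
    using snoc.prems w_js by (intro snoc.IH) (auto simp: sorted_wrt_append)
  also have "\<dots> = greedy (\<lambda>j. v j - ?c) w ?js" by (simp add: greedy_snoc)
  finally have 1: "?a * (\<Sum>j\<leftarrow>?js. w j * (v j - ?c)) \<le> greedy (\<lambda>j. v j - ?c) w ?js" by simp
  have "?a * (\<Sum>j\<leftarrow>?js. w j) \<le> 1 - exp (- (\<Sum>j\<leftarrow>?js. w j))"
    using ws by (intro exp_chord) auto
  also have "\<dots> \<le> 1 - (\<Prod>j\<leftarrow>?js. 1 - w j)" using prod_list_le_exp(2)[of ?js w] w1 by simp
  finally have 2: "?c * (?a * (\<Sum>j\<leftarrow>?js. w j)) \<le> ?c * (1 - (\<Prod>j\<leftarrow>?js. 1 - w j))"
    using snoc.prems(2)[of k] by (intro mult_left_mono) auto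
  have "(\<Sum>j\<leftarrow>?js. w j * v j) = (\<Sum>j\<leftarrow>?js. w j * (v j - ?c)) + ?c * (\<Sum>j\<leftarrow>?js. w j)"
    by (rule sum_list_shift)
  then have "?a * (\<Sum>j\<leftarrow>?js. w j * v j) = ?a * (\<Sum>j\<leftarrow>?js. w j * (v j - ?c)) + ?c * (?a * (\<Sum>j\<leftarrow>?js. w j))"
    by (simp add: algebra_simps)
  then show ?case using 1 2 greedy_shift[of v w ?js ?c] by linarith
qed simp

lemma best_le_sum: "(\<And>j. j \<in> set js \<Longrightarrow> 0 \<le> v j) \<Longrightarrow> best v js A \<le> (\<Sum>j\<leftarrow>js. v j)"
  by (induction js) (auto simp: add_increasing intro!: sum_list_nonneg)

lemma best_cong: "(\<And>j. j \<in> set js \<Longrightarrow> j \<in> A \<longleftrightarrow> j \<in> B) \<Longrightarrow> best v js A = best v js B"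
  by (induction js) auto

lemma best_in: "best v js A \<noteq> 0 \<Longrightarrow> \<exists>j\<in>A. best v js A = v j"
  by (induction js) (auto split: if_splits)

text \<open>Serves \<open>gain_Cons\<close>, where \<open>Y\<close> is the part common to two gains.
  It is finite because \<open>b\<close> is, so the subtraction can be done in the reals.\<close>

lemma ennreal_split_le:
  assumes "ennreal b = X + Y" "X = ennreal a" "ennreal g = Y + Z" "Z \<le> ennreal c"
    and "0 \<le> a" "0 \<le> c" "0 \<le> b"
  shows "a + (g - c) \<le> b"
proof -
  have "Y \<noteq> \<top>" using assms(1) by (metis ennreal_add_eq_top ennreal_neq_top)
  then obtain y where y: "Y = ennreal y" "y \<ge> 0" by (cases Y) auto
  have "ennreal g \<le> ennreal (y + c)"
    using assms y by (simp add: add_left_mono)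
  then have "g \<le> y + c" using y(2) assms(6) by (subst (asm) ennreal_le_iff) simp_all
  moreover have "ennreal b = ennreal (a + y)" using assms y by simp
  then have "b = a + y" using assms y by (subst (asm) ennreal_inj) auto
  ultimately show ?thesis by simp
qed

section \<open>The gain of the algorithm in one time step\<close>

context sse_alg
begin

lemma val_pos: "j \<in> {1..opts I} \<Longrightarrow> val I j > 0"
  using inst by (simp add: sse_instance_def)

definition gain :: "nat \<Rightarrow> nat list \<Rightarrow> real" where
  "gain t js = enn2real (\<integral>\<^sup>+(S, E, h, K). \<integral>\<^sup>+b. ennreal (best (val I) js (considered t S E h K b))
    \<partial>coin_law t \<partial>D t)"

lemma gain_eq:
  assumes "set js \<subseteq> {1..opts I}"
  shows "(\<integral>\<^sup>+(S, E, h, K). \<integral>\<^sup>+b. ennreal (best (val I) js (considered t S E h K b)) \<partial>coin_law t \<partial>D t)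
    = ennreal (gain t js)"
proof -
  have v: "0 \<le> val I j" if "j \<in> set js" for j using assms that
    by (meson less_imp_le subsetD val_pos)
  have "(\<integral>\<^sup>+(S, E, h, K). \<integral>\<^sup>+b. ennreal (best (val I) js (considered t S E h K b)) \<partial>coin_law t \<partial>D t)
      \<le> (\<integral>\<^sup>+(S, E, h, K). \<integral>\<^sup>+b. ennreal (\<Sum>j\<leftarrow>js. val I j) \<partial>coin_law t \<partial>D t)"
    unfolding case_prod_unfold using v by (intro nn_integral_mono ennreal_leI best_le_sum)
  also have "\<dots> < \<top>" by (simp add: case_prod_unfold)
  finally show ?thesis by (simp add: gain_def)
qed

lemma gain_Cons:
  assumes js: "set (j # js) \<subseteq> {1..opts I}" and "j \<notin> set js"
    and t: "Suc t \<le> opts I * T" and m: "m > 0" "m = (\<Sum>i=1..opts I. x i (Suc t))"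
  shows "x j (Suc t) / 2 * val I j + (1 - x j (Suc t) / m) * gain t js \<le> gain t (j # js)"
proof -
  let ?A = "considered t" and ?v = "val I" and ?x = "x j (Suc t)"
  have j: "j \<in> {1..opts I}" and js': "set js \<subseteq> {1..opts I}" using js by auto
  have x0: "?x \<ge> 0" using x_nonneg j t by simp
  have g0: "gain t js \<ge> 0" by (simp add: gain_def)
  have best_upd: "best ?v js (?A S E h K (b(j := c))) = best ?v js (?A S E h K b)"
    "best ?v js (?A S (E(j := e)) h K b) = best ?v js (?A S E h K b)" for S E h K b c e
    using \<open>j \<notin> set js\<close> by (auto intro!: best_cong simp: considered_def)
  \<comment> \<open>\<open>?X\<close> is the reward from \<open>j\<close>, \<open>?Y\<close> the
    reward from \<open>js\<close> when \<open>j\<close> is not considered, and \<open>?Z\<close> the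
    reward from \<open>js\<close> that is lost when \<open>j\<close> is considered.\<close>
  let ?X = "\<integral>\<^sup>+(S, E, h, K). \<integral>\<^sup>+b. of_bool (j \<in> ?A S E h K b) * ennreal (?v j) \<partial>coin_law t \<partial>D t"
  let ?Y = "\<integral>\<^sup>+(S, E, h, K). \<integral>\<^sup>+b. of_bool (j \<notin> ?A S E h K b) * ennreal (best ?v js (?A S E h K b))
    \<partial>coin_law t \<partial>D t"
  let ?Z = "\<integral>\<^sup>+(S, E, h, K). \<integral>\<^sup>+b. of_bool (j \<in> ?A S E h K b) * ennreal (best ?v js (?A S E h K b))
    \<partial>coin_law t \<partial>D t"
  have "?X = ennreal (coin_prob t j) * (ennreal (ready_prob t j) * ennreal (?v j))"
    by (subst nn_integral_considered[OF j]) (simp_all add: ready_prob_eq[symmetric] case_prod_unfold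
      nn_integral_multc)
  also have "\<dots> = ennreal (?x / 2 * ?v j)"
    unfolding considered_prob(1)[OF j t, symmetric]
    using coin_prob_nonneg[of t j] ready_prob_nonneg[of t j] val_pos[OF j]
      by (simp add: mult.assoc less_imp_le flip: ennreal_mult)
  finally have X: "?X = ennreal (?x / 2 * ?v j)" .
  have "(\<integral>\<^sup>+(S, E, h, K). \<integral>\<^sup>+b. ennreal (best ?v (j # js) (?A S E h K b)) \<partial>coin_law t \<partial>D t) = ?X + ?Y"
    unfolding case_prod_unfold
    by (subst nn_integral_add[symmetric], simp, simp, intro nn_integral_cong,
        subst nn_integral_add[symmetric], simp, simp, intro nn_integral_cong) simp
  then have XY: "ennreal (gain t (j # js)) = ?X + ?Y" using gain_eq[OF js] by simp
  have YZ: "ennreal (gain t js) = ?Y + ?Z"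
    unfolding gain_eq[OF js', symmetric] unfolding case_prod_unfold
    by (subst nn_integral_add[symmetric], simp, simp, intro nn_integral_cong,
        subst nn_integral_add[symmetric], simp, simp, intro nn_integral_cong) simp
  let ?\<psi> = "\<lambda>S E h K. of_bool (dm_free S h (Suc t)) * (\<integral>\<^sup>+b. ennreal (best ?v js (?A S E h K b))
    \<partial>coin_law t)"
  have "?Z = ennreal (coin_prob t j) * (\<integral>\<^sup>+(S, E, h, K). of_bool (j \<notin> used h K \<and> E j > Suc t)
    * ?\<psi> S E h K \<partial>D t)"
    by (subst nn_integral_considered[OF j], simp only: best_upd, rule arg_cong2[where f = "(*)", OF
      refl], rule nn_integral_cong) auto
  \<comment> \<open>The best option of \<open>js\<close> does not depend on \<open>E j\<close>, as
    \<open>j \<notin> set js\<close>, so \<open>surv_given_unused\<close> bounds the survival of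
    \<open>j\<close> by its probability. This takes the place of independence between the
    options.\<close>
  also have "\<dots> \<le> ennreal (coin_prob t j) * (ennreal (surv I j (Suc t))
    * (\<integral>\<^sup>+(S, E, h, K). of_bool (j \<notin> used h K) * ?\<psi> S E h K \<partial>D t))"
    by (intro mult_left_mono surv_given_unused[OF j]) (simp_all add: best_upd del: fun_upd_apply)
  also have "\<dots> \<le> ennreal (coin_prob t j) * (ennreal (surv I j (Suc t)) * ennreal (gain t js))"
    unfolding gain_eq[OF js', symmetric] by (intro mult_left_mono nn_integral_mono) auto
  also have "\<dots> = ennreal (coin_prob t j * surv I j (Suc t) * gain t js)"
    using coin_prob_nonneg[of t j] surv_pos[OF j] g0
      by (simp add: mult.assoc less_imp_le flip: ennreal_mult)
  also have "\<dots> \<le> ennreal (?x / m * gain t js)"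
    using considered_prob(2)[OF j t] m g0
      by (intro ennreal_leI mult_right_mono) (simp_all add: pos_le_divide_eq)
  finally have Z: "?Z \<le> ennreal (?x / m * gain t js)" .
  have "?x / 2 * ?v j + (gain t js - ?x / m * gain t js) \<le> gain t (j # js)"
    using XY X YZ Z
  proof (rule ennreal_split_le)
    show "0 \<le> ?x / 2 * ?v j" "0 \<le> ?x / m * gain t js" "0 \<le> gain t (j # js)"
      using x0 m g0 val_pos[OF j] by (simp_all add: gain_def)
  qed
  then show ?thesis by (simp add: algebra_simps)
qed

text \<open>With the factor \<open>m / 2\<close> the weights \<open>x\<^sub>j / m\<close> become the
  probabilities \<open>x\<^sub>j / 2\<close>, and \<open>greedy\<close> satisfies the recursion of
  \<open>gain_Cons\<close> with equality.\<close>

lemma gain_greedy: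
  assumes "set js \<subseteq> {1..opts I}" "distinct js" "Suc t \<le> opts I * T"
    and m: "m > 0" "m = (\<Sum>i=1..opts I. x i (Suc t))"
  shows "m / 2 * greedy (val I) (\<lambda>j. x j (Suc t) / m) js \<le> gain t js"
  using assms(1,2)
proof (induction js)
  case Nil
  then show ?case by (simp add: gain_def)
next
  case (Cons j js)
  have "x j (Suc t) \<le> m"
    unfolding m(2) by (rule member_le_sum) (use Cons.prems x_nonneg assms(3) in auto)
  then have "(1 - x j (Suc t) / m) * (m / 2 * greedy (val I) (\<lambda>j. x j (Suc t) / m) js)
    \<le> (1 - x j (Suc t) / m) * gain t js"
    using Cons m(1) by (intro mult_left_mono) auto
  moreover have "m / 2 * greedy (val I) (\<lambda>j. x j (Suc t) / m) (j # js)
     = x j (Suc t) / 2 * val I j + (1 - x j (Suc t) / m)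
       * (m / 2 * greedy (val I) (\<lambda>j. x j (Suc t) / m) js)"
    using m(1) by (simp add: field_simps)
  moreover have "x j (Suc t) / 2 * val I j + (1 - x j (Suc t) / m) * gain t js \<le> gain t (j # js)"
    using gain_Cons[OF Cons.prems(1) _ assms(3) m] Cons.prems(2) by simp
  ultimately show ?case by linarith
qed

text \<open>The selected option has maximum value among the considered ones, so it is worth at least
  the best of them from any list \<open>js\<close>, and it was not selected before.\<close>

lemma gain_le_reward:
  assumes "set js \<subseteq> {1..opts I}"
  shows "expected_reward I (D t) + gain t js \<le> expected_reward I (D (Suc t))"
proof -
  let ?V = "\<lambda>h. \<Sum>i=1..opts I. ennreal (val I i) * of_bool (i \<in> selected h)"
  have er: "ennreal (expected_reward I (D t)) = (\<integral>\<^sup>+(S, E, h, K). ?V h \<partial>D t)" for t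
  proof -
    have "(\<integral>\<^sup>+(S, E, h, K). ?V h \<partial>D t) = (\<Sum>i=1..opts I. ennreal (val I i)
      * (\<integral>\<^sup>+(S, E, h, K). of_bool (i \<in> selected h) \<partial>D t))"
      by (simp add: case_prod_unfold nn_integral_sum nn_integral_cmult del: sum_mult_of_bool_eq)
    also have "\<dots> = (\<Sum>i=1..opts I. ennreal (val I i * measure_pmf.prob (D t) {(S, E, h, K). i \<in>
      selected h}))"
      unfolding nn_integral_of_bool using val_pos
        by (intro sum.cong refl) (simp add: ennreal_mult less_imp_le)
    also have "\<dots> = ennreal (expected_reward I (D t))"
      unfolding expected_reward_eq using val_pos by (intro sum_ennreal) (simp add: less_imp_le)
    finally show ?thesis ..
  qed
  have "ennreal (expected_reward I (D t)) + ennreal (gain t js)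
     = (\<integral>\<^sup>+(S, E, h, K). \<integral>\<^sup>+b. ?V h + ennreal (best (val I) js (considered t S E h K b)) \<partial>coin_law t
       \<partial>D t)"
    unfolding er gain_eq[OF assms, symmetric] case_prod_unfold by (simp add: nn_integral_add)
  also have "\<dots> \<le> (\<integral>\<^sup>+(S, E, h, K). ?V h \<partial>D (Suc t))"
    unfolding nn_integral_Suc_coins
  proof (intro nn_integral_mono, clarify, intro nn_integral_mono)
    fix S E h K b
    let ?A = "considered t S E h K b"
    show "?V h + ennreal (best (val I) js ?A) \<le> ?V (next_log t h ?A)"
    proof (cases "best (val I) js ?A = 0")
      case True
      have "selected h \<subseteq> selected (next_log t h ?A)" by (auto simp: next_log_def)
      then have "?V h \<le> ?V (next_log t h ?A)" by (intro sum_mono mult_left_mono) auto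
      then show ?thesis by (simp only: True ennreal_0 add_0_right)
    next
      case False
      then obtain j where j: "j \<in> ?A" "best (val I) js ?A = val I j" using best_in by blast
      then have A: "?A \<noteq> {}" by auto
      have sub: "?A \<subseteq> {1..opts I} - used h K" by (rule considered_subset)
      let ?i = "pick ?A"
      have i: "?i \<in> ?A" by (rule pick_considered[OF A])
      have "val I j \<le> val I ?i" using max_pick A j(1) sub unfolding max_pick_def
        by (meson Diff_subset order_trans)
      moreover have "?V (next_log t h ?A) = ?V h + ennreal (val I ?i)"
      proof -
        have "?V (next_log t h ?A) = (\<Sum>k=1..opts I. ennreal (val I k) * of_bool (k \<in> selected h)
          + (if k = ?i then ennreal (val I ?i) else 0))"
          using A i sub by (intro sum.cong refl) (auto simp: next_log_def used_def)
        also have "\<dots> = ?V h + ennreal (val I ?i)"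
          using i sub by (subst sum.distrib) auto
        finally show ?thesis .
      qed
      ultimately show ?thesis using j by (simp add: ennreal_leI add_left_mono)
    qed
  qed
  also have "\<dots> = ennreal (expected_reward I (D (Suc t)))" by (rule er[symmetric])
  finally have "ennreal (expected_reward I (D t) + gain t js)
    \<le> ennreal (expected_reward I (D (Suc t)))"
    using val_pos by (subst ennreal_plus) (auto simp: gain_def expected_reward_eq less_imp_le
      intro!: sum_nonneg mult_nonneg_nonneg)
  moreover have "expected_reward I (D (Suc t)) \<ge> 0"
    using val_pos by (auto simp: expected_reward_eq less_imp_le intro!: sum_nonneg
      mult_nonneg_nonneg)
  ultimately show ?thesis by (simp add: ennreal_le_iff)
qed

lemma reward_Suc:
  assumes t: "Suc t \<le> opts I * T"
  shows "expected_reward I (D t) + (1 - 1 / exp 1) / 2 * (\<Sum>j=1..opts I. val I j * x j (Suc t))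
    \<le> expected_reward I (D (Suc t))"
proof -
  define m where "m = (\<Sum>i=1..opts I. x i (Suc t))"
  have x0: "x j (Suc t) \<ge> 0" if "j \<in> {1..opts I}" for j using x_nonneg that t by simp
  define js where "js = rev (sort_key (val I) [1..<Suc (opts I)])"
  have js: "set js = {1..opts I}" "distinct js" "sorted_wrt (\<lambda>i j. val I i \<ge> val I j) js"
    using sorted_sort_key[of "val I" "[1..<Suc (opts I)]"]
    by (auto simp: js_def sorted_wrt_rev sorted_map simp del: upt_Suc)
  have sum_js: "(\<Sum>j\<leftarrow>js. g j) = (\<Sum>j=1..opts I. g j)" for g :: "nat \<Rightarrow> real"
    using js by (simp add: sum_list_distinct_conv_sum_set)
  show ?thesis
  proof (cases "m > 0")
    case True
    have "(1 - 1 / exp 1) * (\<Sum>j\<leftarrow>js. x j (Suc t) / m * val I j)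
      \<le> greedy (val I) (\<lambda>j. x j (Suc t) / m) js"
    proof (rule greedy_bound)
      have "(\<Sum>j\<leftarrow>js. x j (Suc t) / m) = m / m" unfolding sum_js
        by (simp only: m_def sum_divide_distrib[symmetric])
      then show "(\<Sum>j\<leftarrow>js. x j (Suc t) / m) \<le> 1" by simp
    qed (use js x0 val_pos True in \<open>auto simp: less_imp_le\<close>)
    then have "m / 2 * ((1 - 1 / exp 1) * (\<Sum>j\<leftarrow>js. x j (Suc t) / m * val I j))
      \<le> m / 2 * greedy (val I) (\<lambda>j. x j (Suc t) / m) js"
      using True by (intro mult_left_mono) auto
    also have "\<dots> \<le> gain t js"
      by (rule gain_greedy) (use js t True m_def in auto)
    also have "m / 2 * ((1 - 1 / exp 1) * (\<Sum>j\<leftarrow>js. x j (Suc t) / m * val I j))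
      = (1 - 1 / exp 1) / 2 * (\<Sum>j=1..opts I. val I j * x j (Suc t))"
      unfolding sum_js using True by (simp add: sum_distrib_left sum_distrib_right mult_ac)
    finally have "(1 - 1 / exp 1) / 2 * (\<Sum>j=1..opts I. val I j * x j (Suc t)) \<le> gain t js" .
    moreover have "expected_reward I (D t) + gain t js \<le> expected_reward I (D (Suc t))"
      by (rule gain_le_reward) (simp add: js)
    ultimately show ?thesis by linarith
  next
    \<comment> \<open>Here \<open>m = 0\<close>, so all \<open>x j (Suc t)\<close> vanish. It
      remains that the reward does not decrease, which is the case of the empty list.\<close>
    case False
    have "m \<ge> 0" unfolding m_def using x0 by (intro sum_nonneg)
    then have "(\<Sum>i=1..opts I. x i (Suc t)) = 0" using False by (simp add: m_def)
    then have "x j (Suc t) = 0" if "j \<in> {1..opts I}" for j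
      using x0 that by (subst (asm) sum_nonneg_eq_0_iff) auto
    then show ?thesis using gain_le_reward[of "[]" t] by (simp add: gain_def case_prod_unfold)
  qed
qed

lemma reward_ge_lp: "expected_reward I (D (opts I * T)) \<ge> (1 - 1 / exp 1) / 2 * lp_objective I T x"
proof -
  have "expected_reward I (D t) \<ge> (1 - 1 / exp 1) / 2 * (\<Sum>\<tau><t. \<Sum>j=1..opts I. val I j * x j (Suc \<tau>))"
    if "t \<le> opts I * T" for t
    using that
  proof (induction t)
    case 0
    have "expected_reward I (D 0) \<ge> 0"
      using val_pos by (auto simp: expected_reward_eq less_imp_le intro!: sum_nonneg
        mult_nonneg_nonneg)
    then show ?case by simp
  next
    case (Suc t)
    have "(1 - 1 / exp 1) / 2 * (\<Sum>\<tau><Suc t. \<Sum>j=1..opts I. val I j * x j (Suc \<tau>))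
        = (1 - 1 / exp 1) / 2 * (\<Sum>\<tau><t. \<Sum>j=1..opts I. val I j * x j (Suc \<tau>))
        + (1 - 1 / exp 1) / 2 * (\<Sum>j=1..opts I. val I j * x j (Suc t))"
      by (simp only: sum.lessThan_Suc distrib_left)
    moreover have "t \<le> opts I * T" using Suc.prems by simp
    ultimately show ?case using Suc.IH reward_Suc[OF Suc.prems] by linarith
  qed
  from this[of "opts I * T"] show ?thesis
    by (simp add: lp_objective_def sum.atLeast1_atMost_eq flip: lessThan_Suc_atMost)
qed

end

section \<open>Combination of the two bounds\<close>

theorem theorem3p2:
  fixes I :: sse and T :: nat
    and x :: "nat \<Rightarrow> nat \<Rightarrow> real"
    and pick :: "nat set \<Rightarrow> nat"
    and r :: "'m rule" and m :: 'm
  assumes "sse_instance I T"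
    and "lp_optimal I T x"
    and "\<And>j t. t > opts I * T \<Longrightarrow> x j t = 0"
    and "max_pick I pick"
    and "online_policy I r"
  shows "alg_value I x pick \<ge> 1 / 2 * (1 - 1 / exp 1) * policy_value I r m"
proof -
  interpret alg: sse_alg I T x pick
    using assms by unfold_locales (auto simp: lp_optimal_def)
  interpret policy: process I T "run I r m" "\<lambda>_. r" m
    using assms by unfold_locales auto
  have pos: "\<forall>j\<in>{1..opts I}. val I j > 0" using assms(1) by (simp add: sse_instance_def)
  \<comment> \<open>The bound holds for every horizon \<open>t\<close>, also beyond
    \<open>nT\<close>, so it passes to the limit.\<close>
  have "expected_reward I (run I r m t) \<le> lp_objective I T x" for t
  proof (rule policy.expected_reward_le_lp[of t])
    fix y assume "lp_feasible I T y" "expected_reward I (run I r m t) = lp_objective I T y"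
    then show "expected_reward I (run I r m t) \<le> lp_objective I T x"
      using assms(2) by (simp add: lp_optimal_def)
  qed
  then have "policy_value I r m \<le> lp_objective I T x"
    unfolding policy_value_def
    by (intro LIMSEQ_le_const2[OF convergent_LIMSEQ_iff[THEN iffD1, OF
      convergent_expected_reward_run[OF assms(1,5)]]]) auto
  then have "1 / 2 * (1 - 1 / exp 1) * policy_value I r m \<le> (1 - 1 / exp 1) / 2 * lp_objective I T
    x"
    by (simp add: mult_left_mono)
  also have "\<dots> \<le> expected_reward I (alg_run I x pick (opts I * T))" by (rule alg.reward_ge_lp)
  \<comment> \<open>Selections after time \<open>nT\<close> can only add to the value of the
    algorithm.\<close>
  also have "\<dots> \<le> alg_value I x pick"
    unfolding alg_value_def
  proof (rule incseq_le)
    show "incseq (\<lambda>t. expected_reward I (alg_run I x pick t))"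
      using expected_reward_step[OF log_ok_alg_run[OF assms(4)] online_policy_alg_rule[OF assms(4)]
        pos]
      by (simp add: incseq_Suc_iff Let_def alg_run.simps)
    show "(\<lambda>t. expected_reward I (alg_run I x pick t)) \<longlonglongrightarrow> lim (\<lambda>t. expected_reward I
      (alg_run I x pick t))"
      using convergent_expected_reward_alg_run[OF assms(1,4)] by (simp add: convergent_LIMSEQ_iff)
  qed
  finally show ?thesis .
qed

end
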